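(* Let $\varepsilon>0$, $d\in\mathbb{N}$ and $q\in\mathbb{Z}_{\geq 0}$. Then there exists a constant $C=C_{\varepsilon,d,q}\geq 1$ depending only on $\varepsilon$, $d$ and $q$ such that the following hold. (i) $\mathcal{F}\left(\mathbb{Z}^d\times\{(1+\varepsilon)^m:m\in\mathbb{N}\}^q,\|\cdot\|_\infty\right)$ is $C$-isomorphic to a $C$-complemented subspace of $\mathcal{F}\left(\mathbb{Z}^d,\|\cdot\|_\infty\right)$. (ii) For every $k\in\mathbb{N}$, $\mathcal{F}\left(\mathbb{Z}^d\times\{(1+\varepsilon)^m:m\in\mathbb{N}\}^q,d_k^{\|\cdot\|_\infty}\right)$ is $C$-isomorphic to a $C$-complemented subspace of $\mathcal{F}\left(\mathbb{Z}^d,\|\cdot\|_\infty\right)$.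
   Context: $\mathbb{N}=\{1,2,\dots\}$. All Banach spaces are real. For a metric space $M$ with a chosen basepoint $0_M\in M$, $\mathrm{Lip}_0(M)$ is the Banach space of Lipschitz functions $f:M\to\mathbb{R}$ with $f(0_M)=0$, normed by the Lipschitz constant. For $x\in M$, $\delta_M(x)\in\mathrm{Lip}_0(M)^*$ is the evaluation functional $\delta_M(x)(f)=f(x)$. The Lipschitz-free space is $\mathcal{F}(M)=\overline{\mathrm{span}}^{\|\cdot\|}\{\delta_M(x):x\in M\}\subset\mathrm{Lip}_0(M)^*$; up to isometric isomorphism it does not depend on the basepoint. $\mathcal{F}(M,\rho)$ denotes the Lipschitz-free space over the set $M$ with metric $\rho$; when a norm is written in place of $\rho$, the metric induced by that norm is meant. The set $\mathbb{Z}^d\times\{(1+\varepsilon)^m:m\in\mathbb{N}\}^q$ is regarded as a subset of $\mathbb{R}^{d+q}$. For $k\in\mathbb{N}$, $d_k^{\|\cdot\|_\infty}$ is the truncated metric on $\mathbb{R}^{n}$ (for any $n$), $d_k^{\|\cdot\|_\infty}(x,y)=\min\{\|x-y\|_\infty,k\}$, and its restriction to subsets. For $C\geq 1$, Banach spaces $X,Y$ are $C$-isomorphic if there is a bounded linear bijection $T:X\to Y$ with $\|T\|\cdot\|T^{-1}\|\leq C$; a closed subspace $X$ of a Banach space $Y$ is $C$-complemented in $Y$ if there is a bounded linear projection $P$ of $Y$ onto $X$ with $\|P\|\leq C$. *)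

theory Defs
  imports "HOL-Analysis.Analysis" "HOL-Library.Function_Algebras"
begin

section \<open>Normed spaces with explicit carriers\<close>

instantiation "fun" :: (type, real_vector) real_vector
begin

definition scaleR_fun_def: "r *\<^sub>R f = (\<lambda>x. r *\<^sub>R f x)"

instance
  by standard (simp_all add: scaleR_fun_def fun_eq_iff algebra_simps)

end

lemma scaleR_fun_apply [simp]: "(r *\<^sub>R f) x = r *\<^sub>R f x"
  by (simp add: scaleR_fun_def)

text \<open>
  The Lipschitz-free space depends on a metric that is a term, so it cannot be a type.
  Banach spaces are therefore linear subspaces of a real vector space type together with a norm
  that is only meaningful on the carrier.
\<close>

record 'v nspace =
  carr :: "'v set"
  nrm :: "'v \<Rightarrow> real"

definition normed_on :: "'v::real_vector nspace \<Rightarrow> bool" where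
  "normed_on X \<longleftrightarrow> subspace (carr X) \<and>
     (\<forall>x\<in>carr X. 0 \<le> nrm X x \<and> (nrm X x = 0 \<longleftrightarrow> x = 0)) \<and>
     (\<forall>r. \<forall>x\<in>carr X. nrm X (r *\<^sub>R x) = \<bar>r\<bar> * nrm X x) \<and>
     (\<forall>x\<in>carr X. \<forall>y\<in>carr X. nrm X (x + y) \<le> nrm X x + nrm X y)"

text \<open>
  \<^locale>\<open>Metric_space\<close> asks for nonnegativity and symmetry at all arguments, hence the guard.
\<close>

definition ndist :: "'v::real_vector nspace \<Rightarrow> 'v \<Rightarrow> 'v \<Rightarrow> real" where
  "ndist X x y = (if x \<in> carr X \<and> y \<in> carr X then nrm X (x - y) else 0)"

definition ntopology :: "'v::real_vector nspace \<Rightarrow> 'v topology" where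
  "ntopology X = Metric_space.mtopology (carr X) (ndist X)"

definition real_nspace :: "real nspace" where
  "real_nspace = \<lparr>carr = UNIV, nrm = abs\<rparr>"

definition bounded_linear_on ::
    "'v::real_vector nspace \<Rightarrow> 'w::real_vector nspace \<Rightarrow> ('v \<Rightarrow> 'w) \<Rightarrow> bool" where
  "bounded_linear_on X Y T \<longleftrightarrow> T \<in> carr X \<rightarrow> carr Y \<and>
     (\<forall>x\<in>carr X. \<forall>y\<in>carr X. T (x + y) = T x + T y) \<and>
     (\<forall>r. \<forall>x\<in>carr X. T (r *\<^sub>R x) = r *\<^sub>R T x) \<and>
     (\<exists>K. \<forall>x\<in>carr X. nrm Y (T x) \<le> K * nrm X x)"

text \<open>
  As in \<^const>\<open>onorm\<close>, the vector \<open>x = 0\<close> contributes \<open>0 / 0 = 0\<close>.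
\<close>

definition op_norm :: "'v nspace \<Rightarrow> 'w nspace \<Rightarrow> ('v \<Rightarrow> 'w) \<Rightarrow> real" where
  "op_norm X Y T = (SUP x\<in>carr X. nrm Y (T x) / nrm X x)"

definition C_isomorphic :: "real \<Rightarrow> 'v::real_vector nspace \<Rightarrow> 'w::real_vector nspace \<Rightarrow> bool" where
  "C_isomorphic C X Y \<longleftrightarrow>
     (\<exists>T. bounded_linear_on X Y T \<and> bij_betw T (carr X) (carr Y) \<and>
          bounded_linear_on Y X (inv_into (carr X) T) \<and>
          op_norm X Y T * op_norm Y X (inv_into (carr X) T) \<le> C)"

definition C_complemented :: "real \<Rightarrow> 'v::real_vector set \<Rightarrow> 'v nspace \<Rightarrow> bool" where
  "C_complemented C Z Y \<longleftrightarrow>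
     Z \<subseteq> carr Y \<and> subspace Z \<and> closedin (ntopology Y) Z \<and>
     (\<exists>P. bounded_linear_on Y Y P \<and> P ` carr Y = Z \<and> (\<forall>z\<in>Z. P z = z) \<and> op_norm Y Y P \<le> C)"

definition C_isomorphic_to_C_complemented ::
    "real \<Rightarrow> 'v::real_vector nspace \<Rightarrow> 'w::real_vector nspace \<Rightarrow> bool" where
  "C_isomorphic_to_C_complemented C X Y \<longleftrightarrow>
     (\<exists>Z. C_complemented C Z Y \<and> C_isomorphic C X (Y\<lparr>carr := Z\<rparr>))"

text \<open>
  Functionals on \<open>X\<close> are set to \<open>0\<close> outside the carrier, so that each one is represented by
  exactly one function and the dual is a linear subspace of the function type.
\<close>

definition dual :: "'v::real_vector nspace \<Rightarrow> ('v \<Rightarrow> real) nspace" where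
  "dual X = \<lparr>carr = {\<phi>. bounded_linear_on X real_nspace \<phi> \<and> (\<forall>x. x \<notin> carr X \<longrightarrow> \<phi> x = 0)},
             nrm = op_norm X real_nspace\<rparr>"


section \<open>Lipschitz-free spaces\<close>

text \<open>
  The point \<open>b\<close> is the basepoint. Functions vanish outside \<open>mspace m\<close>; in the Lipschitz
  constant the diagonal contributes \<open>0 / 0 = 0\<close>.
\<close>

definition lip0 :: "'a metric \<Rightarrow> 'a \<Rightarrow> ('a \<Rightarrow> real) nspace" where
  "lip0 m b =
     \<lparr>carr = {f. Lipschitz_continuous_map m euclidean_metric f \<and> f b = 0 \<and>
                 (\<forall>x. x \<notin> mspace m \<longrightarrow> f x = 0)},
      nrm = (\<lambda>f. SUP (x, y)\<in>mspace m \<times> mspace m. \<bar>f x - f y\<bar> / mdist m x y)\<rparr>"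

definition lip_eval :: "'a metric \<Rightarrow> 'a \<Rightarrow> 'a \<Rightarrow> ('a \<Rightarrow> real) \<Rightarrow> real" where
  "lip_eval m b x = (\<lambda>f. if f \<in> carr (lip0 m b) then f x else 0)"

definition lip_free :: "'a metric \<Rightarrow> 'a \<Rightarrow> (('a \<Rightarrow> real) \<Rightarrow> real) nspace" where
  "lip_free m b = (dual (lip0 m b))
     \<lparr>carr := ntopology (dual (lip0 m b)) closure_of span (lip_eval m b ` mspace m)\<rparr>"


section \<open>The metric spaces\<close>

text \<open>
  A vector of length \<open>n\<close> is a function that is \<^const>\<open>undefined\<close> outside \<open>{..<n}\<close>.
  The inserted \<open>0\<close> matters only for \<open>n = 0\<close>.
\<close>

definition sup_dist :: "nat \<Rightarrow> (nat \<Rightarrow> real) \<Rightarrow> (nat \<Rightarrow> real) \<Rightarrow> real" where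
  "sup_dist n x y = Max (insert 0 ((\<lambda>i. \<bar>x i - y i\<bar>) ` {..<n}))"

definition sup_metric :: "nat \<Rightarrow> (nat \<Rightarrow> real) metric" where
  "sup_metric n = metric (extensional {..<n}, sup_dist n)"

definition int_grid :: "nat \<Rightarrow> (nat \<Rightarrow> real) set" where
  "int_grid d = {..<d} \<rightarrow>\<^sub>E \<int>"

definition int_geo_grid :: "real \<Rightarrow> nat \<Rightarrow> nat \<Rightarrow> (nat \<Rightarrow> real) set" where
  "int_geo_grid \<epsilon> d q =
     (\<Pi>\<^sub>E i\<in>{..<d + q}. if i < d then \<int> else {(1 + \<epsilon>) ^ m |m. 1 \<le> m})"


section \<open>Well-definedness\<close>

lemma sup_dist_le_iff: "sup_dist n x y \<le> c \<longleftrightarrow> 0 \<le> c \<and> (\<forall>i<n. \<bar>x i - y i\<bar> \<le> c)"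
  unfolding sup_dist_def by (subst Max_le_iff) auto

lemma sup_dist_nonneg: "0 \<le> sup_dist n x y"
  using sup_dist_le_iff by blast

lemma sup_dist_ge: "i < n \<Longrightarrow> \<bar>x i - y i\<bar> \<le> sup_dist n x y"
  using sup_dist_le_iff by blast

lemma Metric_space_sup_dist: "Metric_space (extensional {..<n}) (sup_dist n)"
proof
  fix x y z :: "nat \<Rightarrow> real"
  show "0 \<le> sup_dist n x y" by (rule sup_dist_nonneg)
  show "sup_dist n x y = sup_dist n y x"
    by (simp add: sup_dist_def abs_minus_commute)
  assume xyz: "x \<in> extensional {..<n}" "y \<in> extensional {..<n}"
  show "sup_dist n x y = 0 \<longleftrightarrow> x = y"
  proof
    assume "sup_dist n x y = 0"
    then have "x i = y i" if "i < n" for i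
      using sup_dist_ge[OF that, of x y] by simp
    then show "x = y"
      by (intro extensionalityI[OF xyz]) auto
  next
    assume "x = y"
    then show "sup_dist n x y = 0"
      using sup_dist_le_iff[of n x y 0] sup_dist_nonneg[of n x y] by simp
  qed
  show "sup_dist n x z \<le> sup_dist n x y + sup_dist n y z"
    unfolding sup_dist_le_iff
  proof (intro conjI allI impI)
    show "0 \<le> sup_dist n x y + sup_dist n y z"
      by (simp add: sup_dist_nonneg)
  next
    fix i assume "i < n"
    then show "\<bar>x i - z i\<bar> \<le> sup_dist n x y + sup_dist n y z"
      using sup_dist_ge[of i n x y] sup_dist_ge[of i n y z] by linarith
  qed
qed

lemma mspace_sup_metric [simp]: "mspace (sup_metric n) = extensional {..<n}"
  and mdist_sup_metric [simp]: "mdist (sup_metric n) = sup_dist n"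
  by (simp_all add: sup_metric_def Metric_space.mspace_metric[OF Metric_space_sup_dist]
      Metric_space.mdist_metric[OF Metric_space_sup_dist])

lemma mspace_int_grid [simp]: "mspace (submetric (sup_metric d) (int_grid d)) = int_grid d"
  by (auto simp: int_grid_def PiE_def)

lemma int_geo_grid_subset: "int_geo_grid \<epsilon> d q \<subseteq> extensional {..<d + q}"
  by (auto simp: int_geo_grid_def PiE_def)

lemma normed_onD:
  assumes "normed_on X"
  shows "subspace (carr X)"
    and "x \<in> carr X \<Longrightarrow> 0 \<le> nrm X x"
    and "x \<in> carr X \<Longrightarrow> nrm X x = 0 \<longleftrightarrow> x = 0"
    and "x \<in> carr X \<Longrightarrow> nrm X (r *\<^sub>R x) = \<bar>r\<bar> * nrm X x"
    and "x \<in> carr X \<Longrightarrow> y \<in> carr X \<Longrightarrow> nrm X (x + y) \<le> nrm X x + nrm X y"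
  using assms by (auto simp: normed_on_def)

lemma normed_on_Metric_space:
  assumes "normed_on X"
  shows "Metric_space (carr X) (ndist X)"
proof
  fix x y z
  have diff: "u - v \<in> carr X" if "u \<in> carr X" "v \<in> carr X" for u v
    by (rule subspace_diff[OF normed_onD(1)[OF assms] that])
  have comm: "nrm X (v - u) = nrm X (u - v)" if "u \<in> carr X" "v \<in> carr X" for u v
    using normed_onD(4)[OF assms diff[OF that], of "-1"] by simp
  show "0 \<le> ndist X x y"
    using normed_onD(2)[OF assms] diff by (simp add: ndist_def)
  show "ndist X x y = ndist X y x"
    using comm by (simp add: ndist_def)
  assume x: "x \<in> carr X" and y: "y \<in> carr X"
  show "ndist X x y = 0 \<longleftrightarrow> x = y"
    using normed_onD(3)[OF assms diff[OF x y]] x y by (simp add: ndist_def)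
  assume z: "z \<in> carr X"
  show "ndist X x z \<le> ndist X x y + ndist X y z"
    using normed_onD(5)[OF assms diff[OF x y] diff[OF y z]] x y z by (simp add: ndist_def)
qed

lemma bounded_linear_on_bdd:
  assumes "normed_on X" "bounded_linear_on X Y T"
  shows "bdd_above ((\<lambda>x. nrm Y (T x) / nrm X x) ` carr X)"
proof -
  obtain K where K: "\<And>x. x \<in> carr X \<Longrightarrow> nrm Y (T x) \<le> K * nrm X x"
    using assms(2) unfolding bounded_linear_on_def by blast
  have "nrm Y (T x) / nrm X x \<le> max K 0" if "x \<in> carr X" for x
  proof (cases "nrm X x = 0")
    case False
    then have "nrm X x > 0" using normed_onD(2)[OF assms(1) that] by simp
    then show ?thesis using K[OF that] by (simp add: divide_le_eq le_max_iff_disj)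
  qed simp
  then show ?thesis by (intro bdd_aboveI2)
qed

lemma op_norm_bound:
  assumes X: "normed_on X" and Y: "normed_on Y" and T: "bounded_linear_on X Y T" and x: "x \<in> carr X"
  shows "nrm Y (T x) \<le> op_norm X Y T * nrm X x"
proof (cases "x = 0")
  case True
  obtain K where "nrm Y (T x) \<le> K * nrm X x"
    using T x by (auto simp: bounded_linear_on_def)
  then show ?thesis
    using normed_onD(3)[OF X x] True by simp
next
  case False
  then have "nrm X x > 0"
    using normed_onD(2,3)[OF X x] by simp
  moreover have "nrm Y (T x) / nrm X x \<le> op_norm X Y T"
    unfolding op_norm_def by (rule cSUP_upper[OF x bounded_linear_on_bdd[OF X T]])
  ultimately show ?thesis
    by (simp add: divide_le_eq)
qed

lemma op_norm_le:
  assumes X: "normed_on X" and "0 \<le> K" and K: "\<And>x. x \<in> carr X \<Longrightarrow> nrm Y (T x) \<le> K * nrm X x"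
  shows "op_norm X Y T \<le> K"
  unfolding op_norm_def
proof (rule cSUP_least)
  show "carr X \<noteq> {}"
    using subspace_0[OF normed_onD(1)[OF X]] by blast
  fix x assume x: "x \<in> carr X"
  show "nrm Y (T x) / nrm X x \<le> K"
  proof (cases "nrm X x = 0")
    case False
    then have "nrm X x > 0" using normed_onD(2)[OF X x] by simp
    then show ?thesis using K[OF x] by (simp add: divide_le_eq)
  qed (use \<open>0 \<le> K\<close> in simp)
qed

lemma op_norm_nonneg:
  assumes X: "normed_on X" and Y: "normed_on Y" and T: "bounded_linear_on X Y T"
  shows "0 \<le> op_norm X Y T"
proof -
  have 0: "0 \<in> carr X"
    by (rule subspace_0[OF normed_onD(1)[OF X]])
  have "nrm X 0 = 0"
    using normed_onD(3)[OF X 0] by simp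
  moreover have "nrm Y (T 0) / nrm X 0 \<le> op_norm X Y T"
    unfolding op_norm_def by (rule cSUP_upper[OF 0 bounded_linear_on_bdd[OF X T]])
  ultimately show ?thesis by (metis div_by_0)
qed

lemma normed_on_real: "normed_on real_nspace"
  by (auto simp: normed_on_def real_nspace_def abs_mult subspace_def)

lemma subspace_dual: "subspace (carr (dual X))"
proof (rule subspaceI)
  show "0 \<in> carr (dual X)"
    by (auto simp: dual_def bounded_linear_on_def real_nspace_def intro!: exI[of _ 0])
next
  fix \<phi> \<psi> assume *: "\<phi> \<in> carr (dual X)" "\<psi> \<in> carr (dual X)"
  have "\<exists>K. \<forall>x\<in>carr X. \<bar>\<phi> x\<bar> \<le> K * nrm X x" "\<exists>K. \<forall>x\<in>carr X. \<bar>\<psi> x\<bar> \<le> K * nrm X x"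
    using * by (simp_all add: dual_def bounded_linear_on_def real_nspace_def)
  then obtain K L where
    KL: "\<forall>x\<in>carr X. \<bar>\<phi> x\<bar> \<le> K * nrm X x" "\<forall>x\<in>carr X. \<bar>\<psi> x\<bar> \<le> L * nrm X x"
    by (elim exE)
  have "\<forall>x\<in>carr X. \<bar>\<phi> x + \<psi> x\<bar> \<le> (K + L) * nrm X x"
  proof
    fix x assume "x \<in> carr X"
    with KL have "\<bar>\<phi> x\<bar> \<le> K * nrm X x" "\<bar>\<psi> x\<bar> \<le> L * nrm X x" by blast+
    then show "\<bar>\<phi> x + \<psi> x\<bar> \<le> (K + L) * nrm X x" unfolding distrib_right by linarith
  qed
  then have "\<exists>K. \<forall>x\<in>carr X. \<bar>\<phi> x + \<psi> x\<bar> \<le> K * nrm X x" ..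
  then show "\<phi> + \<psi> \<in> carr (dual X)"
    using * by (simp add: dual_def bounded_linear_on_def real_nspace_def distrib_left)
next
  fix r \<phi> assume *: "\<phi> \<in> carr (dual X)"
  obtain K where "\<forall>x\<in>carr X. \<bar>\<phi> x\<bar> \<le> K * nrm X x"
    using * by (auto simp: dual_def bounded_linear_on_def real_nspace_def)
  then have "\<forall>x\<in>carr X. \<bar>r * \<phi> x\<bar> \<le> (\<bar>r\<bar> * K) * nrm X x"
    by (auto simp: abs_mult mult.assoc intro: mult_left_mono)
  then have "\<exists>K. \<forall>x\<in>carr X. \<bar>r * \<phi> x\<bar> \<le> K * nrm X x" ..
  then show "r *\<^sub>R \<phi> \<in> carr (dual X)"
    using * by (simp add: dual_def bounded_linear_on_def real_nspace_def distrib_left)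
qed

lemma normed_on_dual:
  assumes X: "normed_on X"
  shows "normed_on (dual X)"
proof -
  have bl: "bounded_linear_on X real_nspace \<phi>" if "\<phi> \<in> carr (dual X)" for \<phi>
    using that by (simp add: dual_def)
  have bound: "\<bar>\<phi> x\<bar> \<le> nrm (dual X) \<phi> * nrm X x" if "\<phi> \<in> carr (dual X)" "x \<in> carr X" for \<phi> x
    using op_norm_bound[OF X normed_on_real bl[OF that(1)] that(2)]
    by (simp add: dual_def real_nspace_def)
  have nonneg: "0 \<le> nrm (dual X) \<phi>" if "\<phi> \<in> carr (dual X)" for \<phi>
    using op_norm_nonneg[OF X normed_on_real bl[OF that]] by (simp add: dual_def)
  have least: "nrm (dual X) \<phi> \<le> K"
    if "0 \<le> K" "\<And>x. x \<in> carr X \<Longrightarrow> \<bar>\<phi> x\<bar> \<le> K * nrm X x" for \<phi> K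
    using op_norm_le[OF X that(1), of real_nspace \<phi>] that(2) by (simp add: dual_def real_nspace_def)
  have hom_le: "nrm (dual X) (r *\<^sub>R \<phi>) \<le> \<bar>r\<bar> * nrm (dual X) \<phi>" if "\<phi> \<in> carr (dual X)" for r \<phi>
  proof (rule least)
    show "0 \<le> \<bar>r\<bar> * nrm (dual X) \<phi>" using nonneg[OF that] by simp
    fix x assume "x \<in> carr X"
    from mult_left_mono[OF bound[OF that this], of "\<bar>r\<bar>"]
    show "\<bar>(r *\<^sub>R \<phi>) x\<bar> \<le> \<bar>r\<bar> * nrm (dual X) \<phi> * nrm X x"
      by (simp add: abs_mult mult.assoc)
  qed
  show ?thesis
    unfolding normed_on_def
  proof (intro conjI ballI allI)
    show "subspace (carr (dual X))" by (rule subspace_dual)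
  next
    fix \<phi> assume \<phi>: "\<phi> \<in> carr (dual X)"
    show "0 \<le> nrm (dual X) \<phi>" by (rule nonneg[OF \<phi>])
    show "nrm (dual X) \<phi> = 0 \<longleftrightarrow> \<phi> = 0"
    proof
      assume "nrm (dual X) \<phi> = 0"
      then have "\<phi> x = 0" for x
        using bound[OF \<phi>, of x] \<phi> by (cases "x \<in> carr X") (auto simp: dual_def)
      then show "\<phi> = 0" by auto
    next
      assume "\<phi> = 0"
      then show "nrm (dual X) \<phi> = 0"
        using least[of 0 \<phi>] nonneg[OF \<phi>] by simp
    qed
  next
    fix r \<phi> assume \<phi>: "\<phi> \<in> carr (dual X)"
    show "nrm (dual X) (r *\<^sub>R \<phi>) = \<bar>r\<bar> * nrm (dual X) \<phi>"
    proof (cases "r = 0")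
      case True
      then show ?thesis
        using hom_le[OF \<phi>, of r] nonneg[OF subspace_scale[OF subspace_dual \<phi>], of r] by simp
    next
      case False
      have "nrm (dual X) \<phi> \<le> \<bar>inverse r\<bar> * nrm (dual X) (r *\<^sub>R \<phi>)"
        using hom_le[OF subspace_scale[OF subspace_dual \<phi>], of "inverse r" r] False by simp
      then have "\<bar>r\<bar> * nrm (dual X) \<phi> \<le> nrm (dual X) (r *\<^sub>R \<phi>)"
        using False by (simp add: field_simps abs_inverse)
      then show ?thesis using hom_le[OF \<phi>, of r] by simp
    qed
  next
    fix \<phi> \<psi> assume *: "\<phi> \<in> carr (dual X)" "\<psi> \<in> carr (dual X)"
    show "nrm (dual X) (\<phi> + \<psi>) \<le> nrm (dual X) \<phi> + nrm (dual X) \<psi>"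
    proof (rule least)
      show "0 \<le> nrm (dual X) \<phi> + nrm (dual X) \<psi>" using nonneg * by simp
      fix x assume "x \<in> carr X"
      then show "\<bar>(\<phi> + \<psi>) x\<bar> \<le> (nrm (dual X) \<phi> + nrm (dual X) \<psi>) * nrm X x"
        using bound[OF *(1), of x] bound[OF *(2), of x]
        unfolding plus_fun_apply distrib_right by linarith
    qed
  qed
qed

lemma lip0_carr_iff:
  "f \<in> carr (lip0 m b) \<longleftrightarrow>
     (\<exists>B\<ge>0. \<forall>x\<in>mspace m. \<forall>y\<in>mspace m. \<bar>f x - f y\<bar> \<le> B * mdist m x y) \<and>
     f b = 0 \<and> (\<forall>x. x \<notin> mspace m \<longrightarrow> f x = 0)"
proof -
  have "(\<exists>B\<ge>0. \<forall>x\<in>mspace m. \<forall>y\<in>mspace m. \<bar>f x - f y\<bar> \<le> B * mdist m x y)"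
    if B: "\<forall>x\<in>mspace m. \<forall>y\<in>mspace m. \<bar>f x - f y\<bar> \<le> B * mdist m x y" for B
  proof (intro exI[of _ "max B 0"] conjI ballI)
    fix x y assume "x \<in> mspace m" "y \<in> mspace m"
    with B have "\<bar>f x - f y\<bar> \<le> B * mdist m x y" by blast
    also have "\<dots> \<le> max B 0 * mdist m x y" by (intro mult_right_mono) auto
    finally show "\<bar>f x - f y\<bar> \<le> max B 0 * mdist m x y" .
  qed simp
  then have "(\<exists>B. \<forall>x\<in>mspace m. \<forall>y\<in>mspace m. \<bar>f x - f y\<bar> \<le> B * mdist m x y) \<longleftrightarrow>
      (\<exists>B\<ge>0. \<forall>x\<in>mspace m. \<forall>y\<in>mspace m. \<bar>f x - f y\<bar> \<le> B * mdist m x y)"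
    by meson
  then show ?thesis
    by (simp add: lip0_def Lipschitz_continuous_map_def dist_real_def)
qed

lemma quotient_le: "a / c \<le> B" if "0 \<le> B" "0 \<le> c" "a \<le> B * c" for a B c :: real
  using that by (cases "c = 0") (auto simp: divide_le_eq less_le)

lemma lip0_Lipschitz:
  assumes "f \<in> carr (lip0 m b)"
  obtains B where "B \<ge> 0"
    and "\<And>x y. x \<in> mspace m \<Longrightarrow> y \<in> mspace m \<Longrightarrow> \<bar>f x - f y\<bar> \<le> B * mdist m x y"
proof -
  have "\<exists>B\<ge>0. \<forall>x\<in>mspace m. \<forall>y\<in>mspace m. \<bar>f x - f y\<bar> \<le> B * mdist m x y"
    using assms by (simp only: lip0_carr_iff)
  then show ?thesis
    by (elim exE conjE) (rule that, auto)
qed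

lemma lip0_bound:
  assumes "f \<in> carr (lip0 m b)" "x \<in> mspace m" "y \<in> mspace m"
  shows "\<bar>f x - f y\<bar> \<le> nrm (lip0 m b) f * mdist m x y"
proof (cases "x = y")
  case False
  obtain B where "B \<ge> 0"
    and B: "\<And>x y. x \<in> mspace m \<Longrightarrow> y \<in> mspace m \<Longrightarrow> \<bar>f x - f y\<bar> \<le> B * mdist m x y"
    using assms(1) by (rule lip0_Lipschitz) blast
  have "bdd_above ((\<lambda>(x, y). \<bar>f x - f y\<bar> / mdist m x y) ` (mspace m \<times> mspace m))"
  proof (intro bdd_aboveI2[where M = B], clarify)
    fix x y assume "x \<in> mspace m" "y \<in> mspace m"
    then show "\<bar>f x - f y\<bar> / mdist m x y \<le> B"
      by (intro quotient_le \<open>B \<ge> 0\<close> mdist_nonneg B)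
  qed
  then have "\<bar>f x - f y\<bar> / mdist m x y \<le> nrm (lip0 m b) f"
    using cSUP_upper[of "(x, y)" "mspace m \<times> mspace m" "\<lambda>(x, y). \<bar>f x - f y\<bar> / mdist m x y"] assms
    by (simp add: lip0_def)
  moreover have "mdist m x y > 0"
    using False assms by (metis mdist_nonneg mdist_zero less_le)
  ultimately show ?thesis by (simp add: divide_le_eq)
next
  case True
  then have "mdist m x y = 0"
    using assms by simp
  then show ?thesis
    using True by simp
qed

lemma lip0_least:
  assumes "b \<in> mspace m" "0 \<le> B"
    and "\<And>x y. x \<in> mspace m \<Longrightarrow> y \<in> mspace m \<Longrightarrow> \<bar>f x - f y\<bar> \<le> B * mdist m x y"
  shows "nrm (lip0 m b) f \<le> B"
proof -
  have "(SUP (x, y)\<in>mspace m \<times> mspace m. \<bar>f x - f y\<bar> / mdist m x y) \<le> B"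
  proof (rule cSUP_least)
    fix p assume "p \<in> mspace m \<times> mspace m"
    then show "(case p of (x, y) \<Rightarrow> \<bar>f x - f y\<bar> / mdist m x y) \<le> B"
      by (auto intro!: quotient_le assms)
  qed (use assms in auto)
  then show ?thesis by (simp add: lip0_def)
qed

lemma lip0_nonneg:
  assumes "b \<in> mspace m" "f \<in> carr (lip0 m b)"
  shows "0 \<le> nrm (lip0 m b) f"
proof (cases "mspace m = {b}")
  case True
  then show ?thesis by (simp add: lip0_def)
next
  case False
  then obtain x where x: "x \<in> mspace m" "x \<noteq> b" using assms by blast
  then have "0 \<le> nrm (lip0 m b) f * mdist m x b"
    using lip0_bound[OF assms(2) x(1) assms(1)] by simp
  moreover have "mdist m x b > 0"
    using x assms by (metis mdist_nonneg mdist_zero less_le)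
  ultimately show ?thesis by (simp add: zero_le_mult_iff)
qed

lemma subspace_lip0: "subspace (carr (lip0 m b))"
proof (rule subspaceI)
  show "0 \<in> carr (lip0 m b)"
    by (auto simp: lip0_carr_iff intro!: exI[of _ 0])
next
  fix f g assume *: "f \<in> carr (lip0 m b)" "g \<in> carr (lip0 m b)"
  obtain B where "B \<ge> 0"
    and B: "\<And>x y. x \<in> mspace m \<Longrightarrow> y \<in> mspace m \<Longrightarrow> \<bar>f x - f y\<bar> \<le> B * mdist m x y"
    using *(1) by (rule lip0_Lipschitz) blast
  obtain C where "C \<ge> 0"
    and C: "\<And>x y. x \<in> mspace m \<Longrightarrow> y \<in> mspace m \<Longrightarrow> \<bar>g x - g y\<bar> \<le> C * mdist m x y"
    using *(2) by (rule lip0_Lipschitz) blast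
  have "\<bar>(f + g) x - (f + g) y\<bar> \<le> (B + C) * mdist m x y" if "x \<in> mspace m" "y \<in> mspace m" for x y
  proof -
    show ?thesis using B[OF that] C[OF that] unfolding plus_fun_apply distrib_right by linarith
  qed
  then have "\<exists>B\<ge>0. \<forall>x\<in>mspace m. \<forall>y\<in>mspace m. \<bar>(f + g) x - (f + g) y\<bar> \<le> B * mdist m x y"
    using \<open>B \<ge> 0\<close> \<open>C \<ge> 0\<close> by (intro exI[of _ "B + C"]) auto
  then show "f + g \<in> carr (lip0 m b)"
    using * unfolding lip0_carr_iff by simp
next
  fix r f assume *: "f \<in> carr (lip0 m b)"
  obtain B where "B \<ge> 0"
    and B: "\<And>x y. x \<in> mspace m \<Longrightarrow> y \<in> mspace m \<Longrightarrow> \<bar>f x - f y\<bar> \<le> B * mdist m x y"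
    using * by (rule lip0_Lipschitz) blast
  have "\<bar>(r *\<^sub>R f) x - (r *\<^sub>R f) y\<bar> \<le> (\<bar>r\<bar> * B) * mdist m x y" if "x \<in> mspace m" "y \<in> mspace m" for x y
  proof -
    have "\<bar>r\<bar> * \<bar>f x - f y\<bar> \<le> \<bar>r\<bar> * (B * mdist m x y)"
      using B[OF that] by (intro mult_left_mono) auto
    then show ?thesis by (simp add: abs_mult mult.assoc flip: right_diff_distrib)
  qed
  then have "\<exists>B\<ge>0. \<forall>x\<in>mspace m. \<forall>y\<in>mspace m. \<bar>(r *\<^sub>R f) x - (r *\<^sub>R f) y\<bar> \<le> B * mdist m x y"
    using \<open>B \<ge> 0\<close> by (intro exI[of _ "\<bar>r\<bar> * B"]) auto
  then show "r *\<^sub>R f \<in> carr (lip0 m b)"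
    using * unfolding lip0_carr_iff by simp
qed

lemma normed_on_lip0:
  assumes b: "b \<in> mspace m"
  shows "normed_on (lip0 m b)"
proof -
  have hom_le: "nrm (lip0 m b) (r *\<^sub>R f) \<le> \<bar>r\<bar> * nrm (lip0 m b) f" if f: "f \<in> carr (lip0 m b)" for r f
  proof (rule lip0_least[OF b])
    show "0 \<le> \<bar>r\<bar> * nrm (lip0 m b) f" using lip0_nonneg[OF b f] by simp
    fix x y assume "x \<in> mspace m" "y \<in> mspace m"
    from mult_left_mono[OF lip0_bound[OF f this], of "\<bar>r\<bar>"]
    show "\<bar>(r *\<^sub>R f) x - (r *\<^sub>R f) y\<bar> \<le> \<bar>r\<bar> * nrm (lip0 m b) f * mdist m x y"
      by (simp add: abs_mult mult.assoc flip: right_diff_distrib)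
  qed
  show ?thesis
    unfolding normed_on_def
  proof (intro conjI ballI allI)
    show "subspace (carr (lip0 m b))" by (rule subspace_lip0)
  next
    fix f assume f: "f \<in> carr (lip0 m b)"
    show "0 \<le> nrm (lip0 m b) f" by (rule lip0_nonneg[OF b f])
    show "nrm (lip0 m b) f = 0 \<longleftrightarrow> f = 0"
    proof
      assume "nrm (lip0 m b) f = 0"
      then have "f x = 0" for x
        using lip0_bound[OF f _ b, of x] f by (cases "x \<in> mspace m") (auto simp: lip0_carr_iff)
      then show "f = 0" by auto
    next
      assume "f = 0"
      then show "nrm (lip0 m b) f = 0"
        using lip0_least[OF b, of 0 f] lip0_nonneg[OF b f] by simp
    qed
  next
    fix r f assume f: "f \<in> carr (lip0 m b)"
    show "nrm (lip0 m b) (r *\<^sub>R f) = \<bar>r\<bar> * nrm (lip0 m b) f"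
    proof (cases "r = 0")
      case True
      then show ?thesis
        using hom_le[OF f, of r] lip0_nonneg[OF b subspace_scale[OF subspace_lip0 f], of r] by simp
    next
      case False
      have "nrm (lip0 m b) f \<le> \<bar>inverse r\<bar> * nrm (lip0 m b) (r *\<^sub>R f)"
        using hom_le[OF subspace_scale[OF subspace_lip0 f], of "inverse r" r] False by simp
      then have "\<bar>r\<bar> * nrm (lip0 m b) f \<le> nrm (lip0 m b) (r *\<^sub>R f)"
        using False by (simp add: field_simps abs_inverse)
      then show ?thesis using hom_le[OF f, of r] by simp
    qed
  next
    fix f g assume *: "f \<in> carr (lip0 m b)" "g \<in> carr (lip0 m b)"
    show "nrm (lip0 m b) (f + g) \<le> nrm (lip0 m b) f + nrm (lip0 m b) g"
    proof (rule lip0_least[OF b])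
      show "0 \<le> nrm (lip0 m b) f + nrm (lip0 m b) g" using lip0_nonneg[OF b] * by simp
      fix x y assume "x \<in> mspace m" "y \<in> mspace m"
      then show "\<bar>(f + g) x - (f + g) y\<bar> \<le> (nrm (lip0 m b) f + nrm (lip0 m b) g) * mdist m x y"
        using lip0_bound[OF *(1), of x y] lip0_bound[OF *(2), of x y]
        unfolding plus_fun_apply distrib_right by linarith
    qed
  qed
qed

lemma lip_eval_in_dual:
  assumes b: "b \<in> mspace m" and x: "x \<in> mspace m"
  shows "lip_eval m b x \<in> carr (dual (lip0 m b))"
proof -
  have "\<bar>f x\<bar> \<le> mdist m x b * nrm (lip0 m b) f" if "f \<in> carr (lip0 m b)" for f
    using lip0_bound[OF that x b] that by (simp add: lip0_carr_iff mult.commute)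
  then have "\<exists>K. \<forall>f\<in>carr (lip0 m b). \<bar>f x\<bar> \<le> K * nrm (lip0 m b) f"
    by blast
  then show ?thesis
    by (simp add: dual_def bounded_linear_on_def real_nspace_def lip_eval_def
        subspace_add[OF subspace_lip0] subspace_scale[OF subspace_lip0])
qed

lemma subspace_closure:
  assumes X: "normed_on X" and S: "subspace S" "S \<subseteq> carr X"
  shows "subspace (ntopology X closure_of S)"
proof -
  interpret Metric_space "carr X" "ndist X" by (rule normed_on_Metric_space[OF X])
  have mem: "x \<in> ntopology X closure_of S \<longleftrightarrow>
      x \<in> carr X \<and> (\<forall>r>0. \<exists>y\<in>S. nrm X (x - y) < r)" for x
  proof -
    have "(\<exists>y\<in>S. y \<in> mball x r) \<longleftrightarrow> (\<exists>y\<in>S. nrm X (x - y) < r)" if "x \<in> carr X" for r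
      using S(2) that by (intro bex_cong) (auto simp: in_mball ndist_def)
    then show ?thesis
      unfolding ntopology_def metric_closure_of by blast
  qed
  note sub = normed_onD(1)[OF X]
  show ?thesis
  proof (rule subspaceI)
    show "0 \<in> ntopology X closure_of S"
      unfolding mem using normed_onD(3)[OF X subspace_0[OF sub]] subspace_0[OF sub] subspace_0[OF S(1)]
      by (auto intro!: bexI[of _ 0])
  next
    fix x y assume *: "x \<in> ntopology X closure_of S" "y \<in> ntopology X closure_of S"
    then have xy: "x \<in> carr X" "y \<in> carr X" by (simp_all add: mem)
    have "\<exists>z\<in>S. nrm X (x + y - z) < r" if "r > 0" for r
    proof -
      obtain u v where uv: "u \<in> S" "v \<in> S" "nrm X (x - u) < r / 2" "nrm X (y - v) < r / 2"
        using * \<open>r > 0\<close> unfolding mem by (meson half_gt_zero)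
      have "nrm X ((x - u) + (y - v)) \<le> nrm X (x - u) + nrm X (y - v)"
        using uv S xy by (intro normed_onD(5)[OF X] subspace_diff[OF sub]) auto
      then have "nrm X (x + y - (u + v)) < r" using uv by (simp add: algebra_simps)
      then show ?thesis using subspace_add[OF S(1) uv(1,2)] by blast
    qed
    then show "x + y \<in> ntopology X closure_of S"
      unfolding mem using subspace_add[OF sub xy] by blast
  next
    fix c x assume *: "x \<in> ntopology X closure_of S"
    then have x: "x \<in> carr X" by (simp add: mem)
    have "\<exists>z\<in>S. nrm X (c *\<^sub>R x - z) < r" if "r > 0" for r
    proof -
      have "r / (\<bar>c\<bar> + 1) > 0" using \<open>r > 0\<close> by simp
      then obtain u where u: "u \<in> S" "nrm X (x - u) < r / (\<bar>c\<bar> + 1)"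
        using * unfolding mem by meson
      have xu: "x - u \<in> carr X" using u S x by (intro subspace_diff[OF sub]) auto
      have "nrm X (c *\<^sub>R x - c *\<^sub>R u) = \<bar>c\<bar> * nrm X (x - u)"
        using normed_onD(4)[OF X xu, of c] by (simp add: scaleR_diff_right)
      also have "\<dots> \<le> (\<bar>c\<bar> + 1) * nrm X (x - u)"
        using normed_onD(2)[OF X xu] by (intro mult_right_mono) auto
      also have "\<dots> < r" using u(2) by (simp add: pos_less_divide_eq mult.commute)
      finally show ?thesis using subspace_scale[OF S(1) u(1)] by blast
    qed
    then show "c *\<^sub>R x \<in> ntopology X closure_of S"
      unfolding mem using subspace_scale[OF sub x] by blast
  qed
qed

lemma normed_on_lip_free:
  assumes b: "b \<in> mspace m"
  shows "normed_on (lip_free m b)"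
proof -
  let ?D = "dual (lip0 m b)"
  let ?S = "span (lip_eval m b ` mspace m)"
  have D: "normed_on ?D" by (intro normed_on_dual normed_on_lip0 b)
  interpret Metric_space "carr ?D" "ndist ?D" by (rule normed_on_Metric_space[OF D])
  have "?S \<subseteq> carr ?D"
    by (rule span_minimal) (use lip_eval_in_dual[OF b] subspace_dual in auto)
  then have "subspace (ntopology ?D closure_of ?S)"
    by (intro subspace_closure[OF D]) auto
  moreover have "ntopology ?D closure_of ?S \<subseteq> carr ?D"
    using closure_of_subset_topspace[of mtopology ?S] by (simp add: ntopology_def)
  ultimately show ?thesis
    using D by (auto simp: normed_on_def lip_free_def subset_iff)
qed

end

theory Submission
  imports Defs
begin

text \<open>
  Write \<open>M\<close> for the grid with the metric in question. It suffices to factor the identity of the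
  Lipschitz functions on \<open>M\<close>, modulo constants, through the Lipschitz functions on \<open>\<int>\<^sup>d\<close>, by two
  operators of bounded norm for which each value of the image is a finite combination of values of the
  argument (\<open>lip_free_complementedI\<close>). Such operators are adjoints of operators between the free
  spaces, and the latter identify the free space of \<open>M\<close> with the range of a projection.

  A function \<open>f\<close> on \<open>M\<close> is cut into functions on copies of \<open>\<int>\<^sup>d\<close>, called layers. One layer carries
  \<open>f\<close> on the bottom copy, where all geometric coordinates are \<open>1 + \<epsilon>\<close>. The others carry the increments
  of \<open>f\<close> as the smallest value \<open>\<theta>\<close> among the remaining geometric coordinates drops to \<open>1 + \<epsilon>\<close>. An
  increment is Lipschitz on its layer and bounded by a multiple of \<open>\<theta>\<close>, and of \<open>k\<close> if the metric is
  truncated at \<open>k\<close>. Conversely, any family of functions with these bounds is reassembled to a Lipschitz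
  function on \<open>M\<close>: two points whose geometric coordinates are \<open>\<delta>\<close> apart have the same coordinates
  above a multiple of \<open>\<delta>\<close>, hence share all layers with large \<open>\<theta>\<close>, and each of the at most \<open>q\<close>
  layers with small \<open>\<theta>\<close> contributes a term of order \<open>\<delta>\<close> (\<open>lip_operator_decode\<close>).

  It remains to write countably many such layers on a single copy of \<open>\<int>\<^sup>d\<close>. A layer whose functions
  are bounded by \<open>\<sigma>\<close> is covered by cubes of radius \<open>\<sigma>\<close>, and the bottom layer, if there is no
  truncation, by the cubes of radius \<open>2 ^ n\<close> around the origin. In both cases the functions on a cube
  are no larger than its radius, up to a constant, and there is a partition of unity with bounded
  overlap that varies at the scale of the cubes (\<open>atlas_exists\<close>). So all cubes may be translated to
  pairwise distant places of \<open>\<int>\<^sup>d\<close>, where the restrictions are extended by cutoffs (\<open>spread\<close>), and the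
  partition of unity glues them together again (\<open>collect\<close>).
\<close>

section \<open>Factorizations of the identity and complemented subspaces\<close>

lemma normed_on_restrict:
  assumes "normed_on Y" "subspace Z" "Z \<subseteq> carr Y"
  shows "normed_on (Y\<lparr>carr := Z\<rparr>)"
  using assms by (auto simp: normed_on_def subset_iff)

lemma mem_ntopology_closure:
  assumes X: "normed_on X" and S: "S \<subseteq> carr X"
  shows "x \<in> ntopology X closure_of S \<longleftrightarrow> x \<in> carr X \<and> (\<forall>r>0. \<exists>y\<in>S. nrm X (x - y) < r)"
proof -
  interpret Metric_space "carr X" "ndist X" by (rule normed_on_Metric_space[OF X])
  have "(\<exists>y\<in>S. y \<in> mball x r) \<longleftrightarrow> (\<exists>y\<in>S. nrm X (x - y) < r)" if "x \<in> carr X" for r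
    using S that by (intro bex_cong) (auto simp: in_mball ndist_def)
  then show ?thesis
    unfolding ntopology_def metric_closure_of by blast
qed

text \<open>
  Operators \<open>T : X \<rightarrow> Y\<close> and \<open>R : Y \<rightarrow> X\<close> with \<open>R \<circ> T = id\<close> identify \<open>X\<close> with the range of \<open>T\<close>,
  onto which \<open>T \<circ> R\<close> is a projection.
\<close>

lemma C_isomorphic_to_C_complementedI:
  assumes X: "normed_on X" and Y: "normed_on Y"
    and T: "bounded_linear_on X Y T" and R: "bounded_linear_on Y X R"
    and RT: "\<And>x. x \<in> carr X \<Longrightarrow> R (T x) = x"
    and K: "0 \<le> K" "\<And>x. x \<in> carr X \<Longrightarrow> nrm Y (T x) \<le> K * nrm X x"
    and L: "0 \<le> L" "\<And>y. y \<in> carr Y \<Longrightarrow> nrm X (R y) \<le> L * nrm Y y"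
    and C: "K * L \<le> C"
  shows "C_isomorphic_to_C_complemented C X Y"
proof -
  define Z where "Z = T ` carr X"
  note subX = normed_onD(1)[OF X] and subY = normed_onD(1)[OF Y]
  have Tmem: "T x \<in> carr Y" if "x \<in> carr X" for x
    using T that by (auto simp: bounded_linear_on_def)
  have Rmem: "R y \<in> carr X" if "y \<in> carr Y" for y
    using R that by (auto simp: bounded_linear_on_def)
  have Tadd: "T (x + y) = T x + T y" if "x \<in> carr X" "y \<in> carr X" for x y
    using T that by (auto simp: bounded_linear_on_def)
  have Tscale: "T (r *\<^sub>R x) = r *\<^sub>R T x" if "x \<in> carr X" for r x
    using T that by (auto simp: bounded_linear_on_def)
  have Radd: "R (x + y) = R x + R y" if "x \<in> carr Y" "y \<in> carr Y" for x y
    using R that by (auto simp: bounded_linear_on_def)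
  have Rscale: "R (r *\<^sub>R x) = r *\<^sub>R R x" if "x \<in> carr Y" for r x
    using R that by (auto simp: bounded_linear_on_def)
  have T0: "T 0 = 0"
    using Tscale[OF subspace_0[OF subX], of 0] by simp
  have ZY: "Z \<subseteq> carr Y"
    using Tmem by (auto simp: Z_def)
  have subZ: "subspace Z"
  proof (rule subspaceI)
    show "0 \<in> Z"
      using subspace_0[OF subX] T0 by (auto simp: Z_def intro!: image_eqI[of _ _ 0])
    show "x + y \<in> Z" if xy: "x \<in> Z" "y \<in> Z" for x y
    proof -
      obtain u v where "u \<in> carr X" "v \<in> carr X" "x = T u" "y = T v"
        using xy unfolding Z_def by blast
      then show ?thesis
        using Tadd[of u v] subspace_add[OF subX, of u v] by (auto simp: Z_def intro!: image_eqI[of _ _ "u + v"])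
    qed
    show "c *\<^sub>R x \<in> Z" if x: "x \<in> Z" for c x
    proof -
      obtain u where "u \<in> carr X" "x = T u"
        using x unfolding Z_def by blast
      then show ?thesis
        using Tscale[of u c] subspace_scale[OF subX, of u c]
        by (auto simp: Z_def intro!: image_eqI[of _ _ "c *\<^sub>R u"])
    qed
  qed
  have TR: "T (R z) = z" if "z \<in> Z" for z
    using that RT by (auto simp: Z_def)
  have TRbound: "nrm Y (T (R y)) \<le> K * L * nrm Y y" if "y \<in> carr Y" for y
  proof -
    have "nrm Y (T (R y)) \<le> K * nrm X (R y)" using K(2)[OF Rmem[OF that]] .
    also have "\<dots> \<le> K * (L * nrm Y y)" using L(2)[OF that] K(1) by (intro mult_left_mono)
    finally show ?thesis by (simp add: mult.assoc)
  qed
  have P: "bounded_linear_on Y Y (T \<circ> R)"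
    unfolding bounded_linear_on_def
    using Tmem Rmem Tadd Radd Tscale Rscale TRbound by (auto intro!: exI[of _ "K * L"])
  have closed: "closedin (ntopology Y) Z"
  proof -
    have "ntopology Y closure_of Z \<subseteq> Z"
    proof
      fix y assume "y \<in> ntopology Y closure_of Z"
      then have y: "y \<in> carr Y" and *: "\<And>r. r > 0 \<Longrightarrow> \<exists>z\<in>Z. nrm Y (y - z) < r"
        by (auto simp: mem_ntopology_closure[OF Y ZY])
      let ?w = "y - T (R y)"
      have w: "?w \<in> carr Y" using y by (intro subspace_diff[OF subY] Tmem Rmem)
      have "nrm Y ?w \<le> e" if "e > 0" for e
      proof -
        have pos: "e / (1 + K * L) > 0" using that K L by (simp add: add_pos_nonneg)
        then obtain z where z: "z \<in> Z" "nrm Y (y - z) < e / (1 + K * L)" using * by blast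
        let ?v = "y - z"
        have zY: "z \<in> carr Y" using z ZY by auto
        have v: "?v \<in> carr Y" using y zY by (intro subspace_diff[OF subY])
        \<comment> \<open>The projection \<open>T \<circ> R\<close> fixes \<open>z\<close>, so it moves \<open>y\<close> by as little as it moves \<open>y - z\<close>.\<close>
        have "T (R y) = T (R (?v + z))" by simp
        also have "\<dots> = T (R ?v) + z"
          using Radd[OF v zY] Tadd[OF Rmem[OF v] Rmem[OF zY]] TR[OF z(1)] by simp
        finally have eq: "?w = ?v + (-1) *\<^sub>R T (R ?v)" by simp
        have "nrm Y ?w \<le> nrm Y ?v + nrm Y ((-1) *\<^sub>R T (R ?v))"
          unfolding eq by (intro normed_onD(5)[OF Y] v subspace_scale[OF subY] Tmem Rmem)
        also have "nrm Y ((-1) *\<^sub>R T (R ?v)) = nrm Y (T (R ?v))"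
          using normed_onD(4)[OF Y Tmem[OF Rmem[OF v]], of "-1"] by simp
        also have "nrm Y ?v + nrm Y (T (R ?v)) \<le> (1 + K * L) * nrm Y ?v"
          using TRbound[OF v] by (simp add: algebra_simps)
        also have "\<dots> \<le> (1 + K * L) * (e / (1 + K * L))"
          using z(2) K L by (intro mult_left_mono) auto
        also have "\<dots> = e" using pos that by (simp add: add_nonneg_eq_0_iff K L)
        finally show ?thesis .
      qed
      then have "nrm Y ?w \<le> 0" by (rule field_le_epsilon[of _ 0, simplified])
      then have "?w = 0" using normed_onD(2,3)[OF Y w] by simp
      then have "y = T (R y)" by simp
      then show "y \<in> Z" using Rmem[OF y] unfolding Z_def by blast
    qed
    moreover have "Z \<subseteq> topspace (ntopology Y)"
      using ZY Metric_space.topspace_mtopology[OF normed_on_Metric_space[OF Y]] by (simp add: ntopology_def)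
    ultimately show ?thesis using closure_of_subset_eq by metis
  qed
  have "C_complemented C Z Y"
    unfolding C_complemented_def
  proof (intro conjI exI[of _ "T \<circ> R"])
    show "(T \<circ> R) ` carr Y = Z"
    proof
      show "(T \<circ> R) ` carr Y \<subseteq> Z" using Rmem by (auto simp: Z_def)
      show "Z \<subseteq> (T \<circ> R) ` carr Y"
      proof
        fix z assume "z \<in> Z"
        then show "z \<in> (T \<circ> R) ` carr Y" using TR[of z] ZY by (intro image_eqI[of _ _ z]) auto
      qed
    qed
    have "op_norm Y Y (T \<circ> R) \<le> K * L"
      using K L TRbound by (intro op_norm_le Y) auto
    then show "op_norm Y Y (T \<circ> R) \<le> C" using C by simp
  qed (use ZY subZ closed P TR in auto)
  moreover have "C_isomorphic C X (Y\<lparr>carr := Z\<rparr>)"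
    unfolding C_isomorphic_def
  proof (intro exI[of _ T] conjI)
    let ?W = "Y\<lparr>carr := Z\<rparr>"
    let ?I = "inv_into (carr X) T"
    have W: "normed_on ?W" by (rule normed_on_restrict[OF Y subZ ZY])
    have inj: "inj_on T (carr X)" by (rule inj_on_inverseI[of _ R]) (rule RT)
    have I: "?I z = R z" if "z \<in> Z" for z
      using that inj RT by (auto simp: Z_def inv_into_f_f)
    show TW: "bounded_linear_on X ?W T"
      using T by (auto simp: bounded_linear_on_def Z_def)
    show "bij_betw T (carr X) (carr ?W)"
      using inj by (simp add: bij_betw_def Z_def)
    have LI: "nrm X (?I z) \<le> L * nrm ?W z" if "z \<in> Z" for z
      using L(2)[of z] that ZY by (auto simp: I)
    show IW: "bounded_linear_on ?W X ?I"
      unfolding bounded_linear_on_def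
    proof (intro conjI exI[of _ L] ballI allI)
      show "?I \<in> carr ?W \<rightarrow> carr X" using I Rmem ZY by auto
    qed (use LI I Radd[OF subsetD[OF ZY] subsetD[OF ZY]] Rscale[OF subsetD[OF ZY]] subspace_add[OF subZ] subspace_scale[OF subZ] in auto)
    have "op_norm X ?W T \<le> K" using K by (intro op_norm_le X) auto
    moreover have "op_norm ?W X ?I \<le> L" using L(1) LI by (intro op_norm_le W) auto
    ultimately have "op_norm X ?W T * op_norm ?W X ?I \<le> K * L"
      using op_norm_nonneg[OF W X IW] K(1) by (intro mult_mono) auto
    then show "op_norm X ?W T * op_norm ?W X ?I \<le> C" using C by simp
  qed
  ultimately show ?thesis
    unfolding C_isomorphic_to_C_complemented_def by blast
qed


section \<open>Operators on Lipschitz functions and their preadjoints\<close>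

text \<open>Evaluation at a point, on arbitrary functions. It is linear for pointwise operations.\<close>

definition ev :: "'a \<Rightarrow> ('a \<Rightarrow> real) \<Rightarrow> real" where
  "ev x = (\<lambda>f. f x)"

text \<open>Lipschitz continuity on \<open>S\<close>, with the constant \<open>L\<close>, for the distance \<open>\<rho>\<close>.\<close>

definition lip_le :: "'a set \<Rightarrow> ('a \<Rightarrow> 'a \<Rightarrow> real) \<Rightarrow> real \<Rightarrow> ('a \<Rightarrow> real) \<Rightarrow> bool" where
  "lip_le S \<rho> L f \<longleftrightarrow> (\<forall>x\<in>S. \<forall>y\<in>S. \<bar>f x - f y\<bar> \<le> L * \<rho> x y)"

text \<open>
  A Lipschitz operator of constant \<open>K\<close> turns functions on \<open>S\<close> into functions on \<open>S'\<close> and multiplies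
  Lipschitz constants by at most \<open>K\<close>. Each value of the new function is a finite linear combination
  of values of the old one; this makes the operator linear and the adjoint of an operator between the
  free spaces.
\<close>

definition lip_operator ::
    "'a set \<Rightarrow> ('a \<Rightarrow> 'a \<Rightarrow> real) \<Rightarrow> 'b set \<Rightarrow> ('b \<Rightarrow> 'b \<Rightarrow> real) \<Rightarrow> real \<Rightarrow>
      (('a \<Rightarrow> real) \<Rightarrow> 'b \<Rightarrow> real) \<Rightarrow> bool" where
  "lip_operator S \<rho> S' \<rho>' K A \<longleftrightarrow>
     (\<forall>x\<in>S'. (\<lambda>f. A f x) \<in> span (ev ` S)) \<and>
     (\<forall>L\<ge>0. \<forall>f. lip_le S \<rho> L f \<longrightarrow> lip_le S' \<rho>' (K * L) (A f))"

lemma span_ev_linear: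
  assumes "\<Phi> \<in> span (ev ` S)"
  shows "\<Phi> (f + g) = \<Phi> f + \<Phi> g" and "\<Phi> (r *\<^sub>R f) = r * \<Phi> f"
proof -
  have "(\<forall>f g. \<Phi> (f + g) = \<Phi> f + \<Phi> g) \<and> (\<forall>r f. \<Phi> (r *\<^sub>R f) = r * \<Phi> f)"
    using assms by (induction rule: span_induct_alt) (auto simp: ev_def algebra_simps)
  then show "\<Phi> (f + g) = \<Phi> f + \<Phi> g" and "\<Phi> (r *\<^sub>R f) = r * \<Phi> f" by auto
qed

lemma span_ev_cong:
  assumes "\<Phi> \<in> span (ev ` S)" "\<And>x. x \<in> S \<Longrightarrow> f x = g x"
  shows "\<Phi> f = \<Phi> g"
  using assms by (induction rule: span_induct_alt) (auto simp: ev_def)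

text \<open>The operator \<open>A\<close> followed by subtraction of the value at the basepoint \<open>b\<close> of \<open>m\<close>.\<close>

definition based :: "'a metric \<Rightarrow> 'a \<Rightarrow> ('c \<Rightarrow> 'a \<Rightarrow> real) \<Rightarrow> 'c \<Rightarrow> 'a \<Rightarrow> real" where
  "based m b A f = (\<lambda>x. if x \<in> mspace m then A f x - A f b else 0)"

text \<open>
  The preadjoint of \<open>based m b A\<close>, extended by \<open>0\<close> outside of the Lipschitz functions on \<open>m'\<close>.
\<close>

definition preadj ::
    "'a metric \<Rightarrow> 'a \<Rightarrow> 'b metric \<Rightarrow> 'b \<Rightarrow> (('b \<Rightarrow> real) \<Rightarrow> 'a \<Rightarrow> real) \<Rightarrow>
      (('a \<Rightarrow> real) \<Rightarrow> real) \<Rightarrow> ('b \<Rightarrow> real) \<Rightarrow> real" where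
  "preadj m b m' b' A \<phi> = (\<lambda>g. if g \<in> carr (lip0 m' b') then \<phi> (based m b A g) else 0)"

lemma dual_carr_iff:
  "\<phi> \<in> carr (dual X) \<longleftrightarrow>
    (\<forall>x\<in>carr X. \<forall>y\<in>carr X. \<phi> (x + y) = \<phi> x + \<phi> y) \<and>
    (\<forall>r. \<forall>x\<in>carr X. \<phi> (r *\<^sub>R x) = r * \<phi> x) \<and>
    (\<exists>K. \<forall>x\<in>carr X. \<bar>\<phi> x\<bar> \<le> K * nrm X x) \<and> (\<forall>x. x \<notin> carr X \<longrightarrow> \<phi> x = 0)"
  by (auto simp: dual_def bounded_linear_on_def real_nspace_def)

lemma dual_bound:
  assumes X: "normed_on X" and "\<phi> \<in> carr (dual X)" "x \<in> carr X"
  shows "\<bar>\<phi> x\<bar> \<le> nrm (dual X) \<phi> * nrm X x"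
  using op_norm_bound[OF X normed_on_real, of \<phi> x] assms(2,3) by (simp add: dual_def real_nspace_def)

lemma dual_least:
  assumes X: "normed_on X" and "0 \<le> K" "\<And>x. x \<in> carr X \<Longrightarrow> \<bar>\<phi> x\<bar> \<le> K * nrm X x"
  shows "nrm (dual X) \<phi> \<le> K"
  using op_norm_le[OF X assms(2), of real_nspace \<phi>] assms(3) by (simp add: dual_def real_nspace_def)

lemma lip_free_carr_iff:
  assumes b: "b \<in> mspace m"
  shows "\<phi> \<in> carr (lip_free m b) \<longleftrightarrow> \<phi> \<in> carr (dual (lip0 m b)) \<and>
    (\<forall>r>0. \<exists>\<psi>\<in>span (lip_eval m b ` mspace m). nrm (dual (lip0 m b)) (\<phi> - \<psi>) < r)"
proof -
  have "span (lip_eval m b ` mspace m) \<subseteq> carr (dual (lip0 m b))"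
    by (rule span_minimal) (use lip_eval_in_dual[OF b] subspace_dual in auto)
  then show ?thesis
    by (simp add: lip_free_def mem_ntopology_closure[OF normed_on_dual[OF normed_on_lip0[OF b]]])
qed

lemma nrm_lip_free: "nrm (lip_free m b) = nrm (dual (lip0 m b))"
  by (simp add: lip_free_def)

text \<open>A Lipschitz operator from the functions on \<open>m'\<close> to those on \<open>m\<close>, and basepoints.\<close>

locale lip_operator_based =
  fixes m :: "'a metric" and b :: 'a and m' :: "'b metric" and b' :: 'b
    and K :: real and A :: "('b \<Rightarrow> real) \<Rightarrow> 'a \<Rightarrow> real"
  assumes b: "b \<in> mspace m" and b': "b' \<in> mspace m'" and K: "0 \<le> K"
    and A: "lip_operator (mspace m') (mdist m') (mspace m) (mdist m) K A"
begin

lemma A_span: "x \<in> mspace m \<Longrightarrow> (\<lambda>f. A f x) \<in> span (ev ` mspace m')"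
  using A by (auto simp: lip_operator_def)

lemma based_mem:
  assumes g: "g \<in> carr (lip0 m' b')"
  shows "based m b A g \<in> carr (lip0 m b)"
    and "nrm (lip0 m b) (based m b A g) \<le> K * nrm (lip0 m' b') g"
proof -
  have "lip_le (mspace m') (mdist m') (nrm (lip0 m' b') g) g"
    using lip0_bound[OF g] by (simp add: lip_le_def)
  then have "lip_le (mspace m) (mdist m) (K * nrm (lip0 m' b') g) (A g)"
    using A lip0_nonneg[OF b' g] by (auto simp: lip_operator_def)
  then have *: "\<bar>based m b A g x - based m b A g y\<bar> \<le> K * nrm (lip0 m' b') g * mdist m x y"
    if "x \<in> mspace m" "y \<in> mspace m" for x y
    using that by (simp add: lip_le_def based_def)
  have 0: "0 \<le> K * nrm (lip0 m' b') g" using lip0_nonneg[OF b' g] K by simp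
  show "based m b A g \<in> carr (lip0 m b)"
    unfolding lip0_carr_iff using * 0 b by (auto simp: based_def intro!: exI[of _ "K * nrm (lip0 m' b') g"])
  show "nrm (lip0 m b) (based m b A g) \<le> K * nrm (lip0 m' b') g"
    by (rule lip0_least[OF b 0 *])
qed

lemma based_linear:
  shows "based m b A (f + g) = based m b A f + based m b A g"
    and "based m b A (r *\<^sub>R f) = r *\<^sub>R based m b A f"
  using span_ev_linear[OF A_span] b by (auto simp: based_def fun_eq_iff algebra_simps)

lemma preadj_dual:
  assumes \<phi>: "\<phi> \<in> carr (dual (lip0 m b))"
  shows "preadj m b m' b' A \<phi> \<in> carr (dual (lip0 m' b'))"
    and "nrm (dual (lip0 m' b')) (preadj m b m' b' A \<phi>) \<le> K * nrm (dual (lip0 m b)) \<phi>"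
proof -
  let ?N = "nrm (dual (lip0 m b)) \<phi>"
  have N: "0 \<le> ?N"
    by (rule normed_onD(2)[OF normed_on_dual[OF normed_on_lip0[OF b]] \<phi>])
  have bd: "\<bar>preadj m b m' b' A \<phi> g\<bar> \<le> (K * ?N) * nrm (lip0 m' b') g" if g: "g \<in> carr (lip0 m' b')" for g
  proof -
    have "\<bar>preadj m b m' b' A \<phi> g\<bar> = \<bar>\<phi> (based m b A g)\<bar>" using g by (simp add: preadj_def)
    also have "\<dots> \<le> ?N * nrm (lip0 m b) (based m b A g)"
      by (rule dual_bound[OF normed_on_lip0[OF b] \<phi> based_mem(1)[OF g]])
    also have "\<dots> \<le> ?N * (K * nrm (lip0 m' b') g)"
      by (intro mult_left_mono based_mem(2)[OF g] N)
    finally show ?thesis by (simp add: mult_ac)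
  qed
  show "nrm (dual (lip0 m' b')) (preadj m b m' b' A \<phi>) \<le> K * ?N"
    using bd N K by (intro dual_least normed_on_lip0 b') auto
  show "preadj m b m' b' A \<phi> \<in> carr (dual (lip0 m' b'))"
    unfolding dual_carr_iff
  proof (intro conjI ballI allI impI exI[of _ "K * ?N"] bd)
    fix f g assume fg: "f \<in> carr (lip0 m' b')" "g \<in> carr (lip0 m' b')"
    then show "preadj m b m' b' A \<phi> (f + g) = preadj m b m' b' A \<phi> f + preadj m b m' b' A \<phi> g"
      using subspace_add[OF subspace_lip0 fg] based_mem(1) \<phi>
      by (auto simp: preadj_def based_linear dual_carr_iff)
  next
    fix r f assume f: "f \<in> carr (lip0 m' b')"
    then show "preadj m b m' b' A \<phi> (r *\<^sub>R f) = r * preadj m b m' b' A \<phi> f"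
      using subspace_scale[OF subspace_lip0 f] based_mem(1) \<phi>
      by (auto simp: preadj_def based_linear dual_carr_iff)
  qed (simp_all add: preadj_def)
qed

lemma preadj_linear:
  shows "preadj m b m' b' A (\<phi> + \<psi>) = preadj m b m' b' A \<phi> + preadj m b m' b' A \<psi>"
    and "preadj m b m' b' A (r *\<^sub>R \<phi>) = r *\<^sub>R preadj m b m' b' A \<phi>"
    and "preadj m b m' b' A (\<phi> - \<psi>) = preadj m b m' b' A \<phi> - preadj m b m' b' A \<psi>"
    and "preadj m b m' b' A 0 = 0"
  by (auto simp: preadj_def fun_eq_iff)

text \<open>
  Here the finite sums in \<^const>\<open>lip_operator\<close> are needed: they keep the preadjoint inside of the
  closed span of the evaluations.
\<close>

lemma preadj_span:
  assumes "\<phi> \<in> span (lip_eval m b ` mspace m)"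
  shows "preadj m b m' b' A \<phi> \<in> span (lip_eval m' b' ` mspace m')"
proof -
  have cut: "(\<lambda>g. if g \<in> carr (lip0 m' b') then \<Phi> g else 0) \<in> span (lip_eval m' b' ` mspace m')"
    if "\<Phi> \<in> span (ev ` mspace m')" for \<Phi>
    using that
  proof (induction rule: span_induct_alt)
    case base
    have "(\<lambda>g. if g \<in> carr (lip0 m' b') then (0 :: _ \<Rightarrow> real) g else 0) = 0" by (auto simp: fun_eq_iff)
    then show ?case by (simp only: span_zero)
  next
    case (step c \<Phi> \<Psi>)
    then obtain z where z: "z \<in> mspace m'" "\<Phi> = ev z" by auto
    have "(\<lambda>g. if g \<in> carr (lip0 m' b') then (c *\<^sub>R \<Phi> + \<Psi>) g else 0) =
        c *\<^sub>R lip_eval m' b' z + (\<lambda>g. if g \<in> carr (lip0 m' b') then \<Psi> g else 0)"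
      by (auto simp: fun_eq_iff z lip_eval_def ev_def)
    also have "\<dots> \<in> span (lip_eval m' b' ` mspace m')"
      using z step by (intro span_add span_scale span_base[OF imageI]) auto
    finally show ?case .
  qed
  have ev: "preadj m b m' b' A (lip_eval m b x) \<in> span (lip_eval m' b' ` mspace m')"
    if x: "x \<in> mspace m" for x
  proof -
    have "preadj m b m' b' A (lip_eval m b x) =
        (\<lambda>g. if g \<in> carr (lip0 m' b') then ((\<lambda>f. A f x) - (\<lambda>f. A f b)) g else 0)"
      using x based_mem(1) by (auto simp: preadj_def lip_eval_def based_def fun_eq_iff)
    also have "\<dots> \<in> span (lip_eval m' b' ` mspace m')"
      by (intro cut span_diff A_span x b)
    finally show ?thesis .
  qed
  show ?thesis
    using assms
  proof (induction rule: span_induct_alt)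
    case base
    show ?case by (simp only: preadj_linear span_zero)
  next
    case (step c \<phi> \<psi>)
    then show ?case unfolding preadj_linear using ev by (intro span_add span_scale) auto
  qed
qed

lemma preadj_lip_free:
  assumes \<phi>: "\<phi> \<in> carr (lip_free m b)"
  shows "preadj m b m' b' A \<phi> \<in> carr (lip_free m' b')"
  unfolding lip_free_carr_iff[OF b']
proof (intro conjI allI impI)
  have \<phi>D: "\<phi> \<in> carr (dual (lip0 m b))" using \<phi> by (simp add: lip_free_carr_iff[OF b])
  then show "preadj m b m' b' A \<phi> \<in> carr (dual (lip0 m' b'))" by (rule preadj_dual)
  fix r :: real assume r: "r > 0"
  have "r / (K + 1) > 0" using r K by simp
  then obtain \<psi> where \<psi>: "\<psi> \<in> span (lip_eval m b ` mspace m)"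
    "nrm (dual (lip0 m b)) (\<phi> - \<psi>) < r / (K + 1)"
    using \<phi> by (auto simp: lip_free_carr_iff[OF b])
  have "span (lip_eval m b ` mspace m) \<subseteq> carr (dual (lip0 m b))"
    by (rule span_minimal) (use lip_eval_in_dual[OF b] subspace_dual in auto)
  then have diff: "\<phi> - \<psi> \<in> carr (dual (lip0 m b))"
    using \<psi>(1) by (intro subspace_diff[OF subspace_dual] \<phi>D) auto
  note N = normed_onD(2)[OF normed_on_dual[OF normed_on_lip0[OF b]] diff]
  have "nrm (dual (lip0 m' b')) (preadj m b m' b' A (\<phi> - \<psi>)) \<le> K * nrm (dual (lip0 m b)) (\<phi> - \<psi>)"
    by (rule preadj_dual(2)[OF diff])
  also have "\<dots> \<le> (K + 1) * nrm (dual (lip0 m b)) (\<phi> - \<psi>)"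
    using N by (intro mult_right_mono) auto
  also have "\<dots> < r"
    using \<psi>(2) K by (simp add: pos_less_divide_eq mult.commute)
  finally show "\<exists>\<psi>\<in>span (lip_eval m' b' ` mspace m').
      nrm (dual (lip0 m' b')) (preadj m b m' b' A \<phi> - \<psi>) < r"
    using preadj_span[OF \<psi>(1)] by (auto simp: preadj_linear)
qed

lemma preadj_bound:
  assumes "\<phi> \<in> carr (lip_free m b)"
  shows "nrm (lip_free m' b') (preadj m b m' b' A \<phi>) \<le> K * nrm (lip_free m b) \<phi>"
  using assms preadj_dual(2) by (simp add: lip_free_carr_iff[OF b] nrm_lip_free)

lemma preadj_bounded_linear:
  "bounded_linear_on (lip_free m b) (lip_free m' b') (preadj m b m' b' A)"
  unfolding bounded_linear_on_def
  using preadj_lip_free preadj_bound by (auto simp: preadj_linear)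

end

text \<open>
  If the identity of the Lipschitz functions on \<open>m\<close>, taken modulo constants, factors through the
  Lipschitz functions on \<open>m'\<close>, then the free space of \<open>m\<close> is complemented in that of \<open>m'\<close>.
\<close>

theorem lip_free_complementedI:
  assumes b: "b \<in> mspace m" and b': "b' \<in> mspace m'" and K: "0 \<le> K" and L: "0 \<le> L"
    and A: "lip_operator (mspace m') (mdist m') (mspace m) (mdist m) K A"
    and B: "lip_operator (mspace m) (mdist m) (mspace m') (mdist m') L B"
    and const: "\<And>g c x. x \<in> mspace m \<Longrightarrow> A (\<lambda>z. g z - c) x = A g x"
    and AB: "\<And>f x. x \<in> mspace m \<Longrightarrow> A (B f) x - A (B f) b = f x - f b"
    and C: "K * L \<le> C"
  shows "C_isomorphic_to_C_complemented C (lip_free m b) (lip_free m' b')"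
proof -
  interpret A: lip_operator_based m b m' b' K A using b b' K A by unfold_locales
  interpret B: lip_operator_based m' b' m b L B using b b' L B by unfold_locales
  \<comment> \<open>Subtracting the value of \<open>B f\<close> at \<open>b'\<close> does no harm, because \<open>A\<close> ignores additive constants.\<close>
  have id: "based m b A (based m' b' B f) = f" if f: "f \<in> carr (lip0 m b)" for f
  proof
    fix x
    have *: "A (based m' b' B f) y = A (B f) y" if "y \<in> mspace m" for y
    proof -
      have "A (based m' b' B f) y = A (\<lambda>z. B f z - B f b') y"
        by (rule span_ev_cong[OF A.A_span[OF that]]) (simp add: based_def)
      then show ?thesis using const[OF that] by simp
    qed
    show "based m b A (based m' b' B f) x = f x"
    proof (cases "x \<in> mspace m")
      case True
      then show ?thesis using *[OF True] *[OF b] AB[OF True, of f] f by (simp add: based_def lip0_carr_iff)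
    next
      case False
      then show ?thesis using f by (simp add: based_def lip0_carr_iff)
    qed
  qed
  show ?thesis
  proof (rule C_isomorphic_to_C_complementedI[OF normed_on_lip_free[OF b] normed_on_lip_free[OF b']
        A.preadj_bounded_linear B.preadj_bounded_linear _ K A.preadj_bound L B.preadj_bound C])
    fix \<phi> assume "\<phi> \<in> carr (lip_free m b)"
    then have "\<phi> \<in> carr (dual (lip0 m b))" by (simp add: lip_free_carr_iff[OF b])
    then show "preadj m' b' m b B (preadj m b m' b' A \<phi>) = \<phi>"
      using B.based_mem(1) by (auto simp: preadj_def id dual_carr_iff)
  qed
qed


section \<open>Partitions of unity on the integer grid\<close>

lemma sup_dist_commute: "sup_dist n x y = sup_dist n y x"
  by (simp add: sup_dist_def abs_minus_commute)

lemma sup_dist_self [simp]: "sup_dist n x x = 0"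
  using sup_dist_le_iff[of n x x 0] sup_dist_nonneg[of n x x] by simp

lemma sup_dist_triangle: "sup_dist n x z \<le> sup_dist n x y + sup_dist n y z"
  unfolding sup_dist_le_iff
proof (intro conjI allI impI)
  show "0 \<le> sup_dist n x y + sup_dist n y z" by (simp add: sup_dist_nonneg)
  fix i assume "i < n"
  then show "\<bar>x i - z i\<bar> \<le> sup_dist n x y + sup_dist n y z"
    using sup_dist_ge[of i n x y] sup_dist_ge[of i n y z] by linarith
qed

lemma sup_dist_diff_le: "\<bar>sup_dist n x z - sup_dist n y z\<bar> \<le> sup_dist n x y"
  using sup_dist_triangle[of n x z y] sup_dist_triangle[of n y z x] sup_dist_commute[of n x y] by linarith

lemma sup_dist_cong:
  "(\<And>i. i < n \<Longrightarrow> \<bar>x i - y i\<bar> = \<bar>x' i - y' i\<bar>) \<Longrightarrow> sup_dist n x y = sup_dist n x' y'"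
  unfolding sup_dist_def by (intro arg_cong[of _ _ Max] arg_cong[of _ _ "insert 0"] image_cong) auto

lemma sum_fun_apply: "(\<Sum>j\<in>S. f j) x = (\<Sum>j\<in>S. f j x)" for f :: "'j \<Rightarrow> 'x \<Rightarrow> real"
  by (induction S rule: infinite_finite_induct) simp_all

lemma lip_leD: "lip_le S \<rho> L f \<Longrightarrow> x \<in> S \<Longrightarrow> y \<in> S \<Longrightarrow> \<bar>f x - f y\<bar> \<le> L * \<rho> x y"
  by (simp add: lip_le_def)

text \<open>
  The product of a bump at scale \<open>s\<close> with a Lipschitz function whose size on the support of the bump
  is comparable to \<open>s\<close> is again Lipschitz, with a constant that does not depend on \<open>s\<close>.
\<close>

lemma bump_mult_diff_le:
  fixes a a' u u' :: real
  assumes a: "\<bar>a\<bar> \<le> 1" "\<bar>a'\<bar> \<le> 1" "\<bar>a - a'\<bar> \<le> K / s * \<delta>" and s: "s > 0"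
    and u: "a \<noteq> 0 \<Longrightarrow> \<bar>u\<bar> \<le> R * s" "a' \<noteq> 0 \<Longrightarrow> \<bar>u'\<bar> \<le> R * s" "\<bar>u - u'\<bar> \<le> L * \<delta>"
    and nonneg: "0 \<le> K" "0 \<le> R" "0 \<le> \<delta>" "0 \<le> L"
  shows "\<bar>a * u - a' * u'\<bar> \<le> (K * R + L) * \<delta>"
proof -
  have *: "\<bar>a * u - a' * u'\<bar> \<le> (K * R + L) * \<delta>"
    if "\<bar>a'\<bar> \<le> 1" "\<bar>a - a'\<bar> \<le> K / s * \<delta>" "\<bar>u\<bar> \<le> R * s" "\<bar>u - u'\<bar> \<le> L * \<delta>" for a a' u u'
  proof -
    have "a * u - a' * u' = (a - a') * u + a' * (u - u')" by (simp add: algebra_simps)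
    then have "\<bar>a * u - a' * u'\<bar> \<le> \<bar>a - a'\<bar> * \<bar>u\<bar> + \<bar>a'\<bar> * \<bar>u - u'\<bar>"
      by (metis abs_mult abs_triangle_ineq)
    also have "\<dots> \<le> (K / s * \<delta>) * (R * s) + 1 * (L * \<delta>)"
      using that nonneg s by (intro add_mono mult_mono) auto
    also have "\<dots> = (K * R + L) * \<delta>" using s by (simp add: field_simps)
    finally show ?thesis .
  qed
  consider "a \<noteq> 0" | "a' \<noteq> 0" | "a = 0" "a' = 0" by blast
  then show ?thesis
  proof cases
    case 1
    show ?thesis by (rule *) (use a u 1 in auto)
  next
    case 2
    have "\<bar>a' * u' - a * u\<bar> \<le> (K * R + L) * \<delta>"
      by (rule *) (use a u 2 in \<open>auto simp: abs_minus_commute\<close>)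
    then show ?thesis by (simp add: abs_minus_commute)
  next
    case 3
    then show ?thesis using nonneg by simp
  qed
qed

text \<open>
  Two sums with few terms each, over different index sets, compared term by term; a term is \<open>0\<close>
  where it is not summed.
\<close>

lemma sum_active_diff_le:
  fixes t t' :: "'j \<Rightarrow> real"
  assumes "finite S" "finite S'" "card S \<le> N" "card S' \<le> N" "0 \<le> B"
    and "\<And>j. j \<in> S \<union> S' \<Longrightarrow> \<bar>t j - t' j\<bar> \<le> B"
    and "\<And>j. j \<in> S' - S \<Longrightarrow> t j = 0" "\<And>j. j \<in> S - S' \<Longrightarrow> t' j = 0"
  shows "\<bar>sum t S - sum t' S'\<bar> \<le> 2 * real N * B"
proof -
  have "sum t S = sum t (S \<union> S')" "sum t' S' = sum t' (S \<union> S')"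
    using assms by (auto intro!: sum.mono_neutral_left)
  then have "\<bar>sum t S - sum t' S'\<bar> = \<bar>\<Sum>j\<in>S \<union> S'. t j - t' j\<bar>" by (simp add: sum_subtractf)
  also have "\<dots> \<le> (\<Sum>j\<in>S \<union> S'. \<bar>t j - t' j\<bar>)" by (rule sum_abs)
  also have "\<dots> \<le> real (card (S \<union> S')) * B" using assms(6) by (rule sum_bounded_above)
  also have "card (S \<union> S') \<le> 2 * N" using card_Un_le[of S S'] assms(3,4) by linarith
  then have "real (card (S \<union> S')) * B \<le> real (2 * N) * B"
    using assms(5) by (intro mult_right_mono) simp_all
  finally show ?thesis by simp
qed

definition grid_origin :: "nat \<Rightarrow> nat \<Rightarrow> real" where
  "grid_origin d = (\<lambda>i\<in>{..<d}. 0)"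

lemma grid_origin_mem: "grid_origin d \<in> int_grid d"
  by (auto simp: grid_origin_def int_grid_def)

text \<open>
  Partitions of unity \<open>\<psi>\<close> of the grid \<open>\<int>\<^sup>d\<close>, in which \<open>\<psi> n\<close> lives on the cube of radius \<open>s n\<close> around
  \<open>c n\<close> and varies at scale \<open>s n\<close>, and at most \<open>N\<close> members are nonzero at any point. For \<open>\<sigma> > 0\<close> all
  cubes have radius \<open>\<sigma>\<close>; the value \<open>\<sigma> = 0\<close> stands for an infinite scale, in which case all cubes are
  centred at the origin. Both kinds are adapted to those functions \<open>g\<close> of Lipschitz constant \<open>1\<close>
  that are bounded by \<open>\<sigma>\<close>, or vanish at the origin: on the cube \<open>n\<close> they are at most of order \<open>s n\<close>.
\<close>

definition atlas ::
    "nat \<Rightarrow> nat \<Rightarrow> real \<Rightarrow> nat \<Rightarrow> (nat \<Rightarrow> nat) \<Rightarrow> (nat \<Rightarrow> nat \<Rightarrow> real) \<Rightarrow>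
      (nat \<Rightarrow> (nat \<Rightarrow> real) \<Rightarrow> real) \<Rightarrow> bool" where
  "atlas d \<sigma> K N s c \<psi> \<longleftrightarrow>
     (\<forall>n. 1 \<le> s n \<and> c n \<in> int_grid d \<and> (if \<sigma> = 0 then c n = grid_origin d else s n = \<sigma>)) \<and>
     (\<forall>x\<in>int_grid d. finite {n. \<psi> n x \<noteq> 0} \<and> card {n. \<psi> n x \<noteq> 0} \<le> N \<and>
        (\<Sum>n | \<psi> n x \<noteq> 0. \<psi> n x) = 1) \<and>
     (\<forall>n. \<forall>x\<in>int_grid d. \<bar>\<psi> n x\<bar> \<le> 1 \<and> (\<psi> n x \<noteq> 0 \<longrightarrow> sup_dist d x (c n) \<le> real (s n)) \<and>
        (\<forall>y\<in>int_grid d. \<bar>\<psi> n x - \<psi> n y\<bar> \<le> K / real (s n) * sup_dist d x y))"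

lemma atlas_mono:
  assumes "atlas d \<sigma> K N s c \<psi>" "K \<le> K'" "N \<le> N'"
  shows "atlas d \<sigma> K' N' s c \<psi>"
proof -
  have "K / real (s n) * sup_dist d x y \<le> K' / real (s n) * sup_dist d x y" for n x y
    using assms(2) by (intro mult_right_mono divide_right_mono sup_dist_nonneg) auto
  then show ?thesis
    using assms(1,3) unfolding atlas_def by (meson order_trans)
qed

text \<open>Infinite scale: a partition of unity by dyadic annuli.\<close>

lemma atlas_annuli: "\<exists>s c \<psi>. atlas d 0 6 2 s c \<psi>"
proof -
  \<comment> \<open>\<open>h n\<close> is \<open>1\<close> up to radius \<open>2 ^ n\<close> and \<open>0\<close> from radius \<open>2 ^ Suc n\<close> on; \<open>w n\<close> lives on an annulus.\<close>
  define h :: "nat \<Rightarrow> real \<Rightarrow> real" where "h n r = max 0 (min 1 (2 - r / 2 ^ n))" for n r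
  define w :: "nat \<Rightarrow> real \<Rightarrow> real" where "w n r = (if n = 0 then h 0 r else h n r - h (n - 1) r)" for n r
  define \<psi> where "\<psi> n x = w n (sup_dist d x (grid_origin d))" for n x
  have h1: "h n r = 1" if "r \<le> 2 ^ n" for n r
    using that by (simp add: h_def field_simps)
  have h0: "h n r = 0" if "2 * 2 ^ n \<le> r" for n r
  proof -
    have "2 \<le> r / 2 ^ n" using that by (simp add: field_simps)
    then show ?thesis by (simp add: h_def)
  qed
  have hlip: "\<bar>h n r - h n r'\<bar> \<le> \<bar>r - r'\<bar> / 2 ^ n" for n r r'
  proof -
    have "\<bar>h n r - h n r'\<bar> \<le> \<bar>r / 2 ^ n - r' / 2 ^ n\<bar>" unfolding h_def by linarith
    also have "\<dots> = \<bar>r - r'\<bar> / 2 ^ n" by (simp flip: diff_divide_distrib)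
    finally show ?thesis .
  qed
  have hmono: "h n r \<le> h (Suc n) r" if "r \<ge> 0" for n r
  proof -
    have "r / 2 ^ Suc n \<le> r / 2 ^ n" using that by (intro divide_left_mono) auto
    then show ?thesis unfolding h_def by linarith
  qed
  have h01: "0 \<le> h n r" "h n r \<le> 1" for n r by (simp_all add: h_def)
  have wlip: "\<bar>w n r - w n r'\<bar> \<le> 6 / 2 ^ Suc n * \<bar>r - r'\<bar>" for n r r'
  proof (cases n)
    case 0
    have "\<bar>w n r - w n r'\<bar> \<le> 1 * \<bar>r - r'\<bar>" using hlip[of 0 r r'] 0 by (simp add: w_def)
    also have "\<dots> \<le> 6 / 2 ^ Suc n * \<bar>r - r'\<bar>" using 0 by (intro mult_right_mono) auto
    finally show ?thesis .
  next
    case (Suc k)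
    then show ?thesis using hlip[of n r r'] hlip[of k r r'] by (simp add: w_def)
  qed
  have wsum: "(\<Sum>n\<le>k. w n r) = h k r" for k r
    by (induction k) (simp_all add: w_def)
  have wsupp: "r \<le> 2 ^ Suc n" if "w n r \<noteq> 0" for n r
  proof (rule ccontr)
    assume *: "\<not> r \<le> 2 ^ Suc n"
    then have "h n r = 0" by (intro h0) simp
    moreover have "h (n - 1) r = 0" if "n > 0"
    proof (rule h0)
      have "(2::real) * 2 ^ (n - 1) = 2 ^ n" using that by (simp flip: power_Suc)
      also have "\<dots> \<le> 2 ^ Suc n" by simp
      also have "\<dots> \<le> r" using * by simp
      finally show "2 * 2 ^ (n - 1) \<le> r" .
    qed
    ultimately show False using that by (auto simp: w_def split: if_splits)
  qed
  have active: "\<exists>k. {n. w n r \<noteq> 0} \<subseteq> {k, Suc k} \<and> r \<le> 2 ^ Suc k" if "r \<ge> 0" for r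
  proof -
    obtain n1 :: nat where "r < 2 ^ n1" using real_arch_pow[of 2 r] by auto
    also have "(2::real) ^ n1 \<le> 2 ^ Suc n1" by simp
    finally have ex: "\<exists>n. r \<le> 2 ^ Suc n" by (intro exI[of _ n1]) simp
    define k where "k = (LEAST n. r \<le> 2 ^ Suc n)"
    have k: "r \<le> 2 ^ Suc k" unfolding k_def using ex by (rule LeastI_ex)
    have "n = k \<or> n = Suc k" if "w n r \<noteq> 0" for n
    proof -
      have "k \<le> n" unfolding k_def using wsupp[OF that] by (rule Least_le)
      moreover have "\<not> Suc k < n"
      proof
        assume *: "Suc k < n"
        then have "(2::real) ^ Suc k \<le> 2 ^ (n - 1)" by (intro power_increasing) auto
        then have "h (n - 1) r = 1" "h n r = 1"
          using k * by (auto intro!: h1 order_trans[OF k] power_increasing)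
        then show False using that * by (simp add: w_def)
      qed
      ultimately show ?thesis by linarith
    qed
    then show ?thesis using k by blast
  qed
  have "atlas d 0 6 2 (\<lambda>n. 2 ^ Suc n) (\<lambda>_. grid_origin d) \<psi>"
    unfolding atlas_def
  proof (intro conjI allI ballI impI)
    fix x :: "nat \<Rightarrow> real"
    let ?r = "sup_dist d x (grid_origin d)"
    obtain k where k: "{n. w n ?r \<noteq> 0} \<subseteq> {k, Suc k}" "?r \<le> 2 ^ Suc k"
      using active[of ?r] sup_dist_nonneg by blast
    show fin: "finite {n. \<psi> n x \<noteq> 0}"
      unfolding \<psi>_def by (rule finite_subset[OF k(1)]) simp
    have "card {n. \<psi> n x \<noteq> 0} \<le> card {k, Suc k}"
      unfolding \<psi>_def by (rule card_mono[OF _ k(1)]) simp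
    then show "card {n. \<psi> n x \<noteq> 0} \<le> 2" by simp
    have "(\<Sum>n | \<psi> n x \<noteq> 0. \<psi> n x) = (\<Sum>n\<le>Suc k. \<psi> n x)"
      using k(1) unfolding \<psi>_def by (intro sum.mono_neutral_left) auto
    also have "\<dots> = 1" unfolding \<psi>_def wsum by (rule h1[OF k(2)])
    finally show "(\<Sum>n | \<psi> n x \<noteq> 0. \<psi> n x) = 1" .
  next
    fix n and x :: "nat \<Rightarrow> real"
    let ?r = "sup_dist d x (grid_origin d)"
    have "h (n - 1) ?r \<le> h n ?r" if "n > 0"
      using hmono[of ?r "n - 1"] that sup_dist_nonneg[of d x "grid_origin d"] by simp
    then show "\<bar>\<psi> n x\<bar> \<le> 1"
      using h01[of n ?r] h01[of "n - 1" ?r] by (auto simp: \<psi>_def w_def)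
    show "sup_dist d x (grid_origin d) \<le> real (2 ^ Suc n)" if "\<psi> n x \<noteq> 0"
      using wsupp[of n ?r] that by (simp add: \<psi>_def)
    fix y :: "nat \<Rightarrow> real"
    have "\<bar>\<psi> n x - \<psi> n y\<bar> \<le> 6 / 2 ^ Suc n * \<bar>?r - sup_dist d y (grid_origin d)\<bar>"
      unfolding \<psi>_def by (rule wlip)
    also have "\<dots> \<le> 6 / 2 ^ Suc n * sup_dist d x y"
      by (intro mult_left_mono sup_dist_diff_le) simp
    finally show "\<bar>\<psi> n x - \<psi> n y\<bar> \<le> 6 / real (2 ^ Suc n) * sup_dist d x y" by simp
  qed (use grid_origin_mem in auto)
  then show ?thesis by blast
qed

lemma infinite_int_grid:
  assumes "d \<ge> 1"
  shows "infinite (int_grid d)"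
proof -
  have "inj (\<lambda>n::nat. \<lambda>i\<in>{..<d}. real n)"
  proof (rule injI)
    fix n k assume "(\<lambda>i\<in>{..<d}. real n) = (\<lambda>i\<in>{..<d}. real k)"
    from fun_cong[OF this, of 0] show "n = k" using assms by simp
  qed
  then have "infinite (range (\<lambda>n::nat. \<lambda>i\<in>{..<d}. real n))" by (rule range_inj_infinite)
  then show ?thesis
    by (rule infinite_super[rotated]) (auto simp: int_grid_def split: if_splits)
qed

lemma countable_int_grid: "countable (int_grid d)"
  unfolding int_grid_def by (intro countable_PiE) (auto simp: Ints_def)

text \<open>Finite scale: products of hat functions centred at the points of the grid \<open>\<sigma>\<int>\<^sup>d\<close>.\<close>

lemma atlas_cubes:
  assumes d: "d \<ge> 1" and \<sigma>: "\<sigma> > 0"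
  shows "\<exists>s c \<psi>. atlas d \<sigma> (real d) (2 ^ d) s c \<psi>"
proof -
  define hat :: "real \<Rightarrow> real" where "hat t = max 0 (1 - \<bar>t\<bar>)" for t
  define \<beta> where "\<beta> v x = (\<Prod>i<d. hat (x i / \<sigma> - v i))" for v x :: "nat \<Rightarrow> real"
  define e where "e = from_nat_into (int_grid d)"
  have e: "bij_betw e UNIV (int_grid d)"
    unfolding e_def by (rule bij_betw_from_nat_into[OF countable_int_grid infinite_int_grid[OF d]])
  have emem: "e n \<in> int_grid d" for n using e by (auto simp: bij_betw_def)
  have hat01: "0 \<le> hat t" "hat t \<le> 1" for t by (auto simp: hat_def)
  have hatlip: "\<bar>hat t - hat t'\<bar> \<le> \<bar>t - t'\<bar>" for t t' by (auto simp: hat_def max_def)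
  have hatsupp: "\<bar>t\<bar> < 1" if "hat t \<noteq> 0" for t using that by (auto simp: hat_def max_def split: if_splits)
  have hatsum: "hat (t - real_of_int \<lfloor>t\<rfloor>) + hat (t - (real_of_int \<lfloor>t\<rfloor> + 1)) = 1" for t
  proof -
    have "real_of_int \<lfloor>t\<rfloor> \<le> t" "t < real_of_int \<lfloor>t\<rfloor> + 1" by linarith+
    then show ?thesis unfolding hat_def by linarith
  qed
  \<comment> \<open>\<open>V x\<close> is the set of corners of the cell of \<open>\<int>\<^sup>d\<close> that contains \<open>x / \<sigma>\<close>.\<close>
  define V where "V x = (\<Pi>\<^sub>E i\<in>{..<d}. {real_of_int \<lfloor>x i / \<sigma>\<rfloor>, real_of_int \<lfloor>x i / \<sigma>\<rfloor> + 1})" for x :: "nat \<Rightarrow> real"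
  have Vfin: "finite (V x)" for x unfolding V_def by (intro finite_PiE) auto
  have Vcard: "card (V x) \<le> 2 ^ d" for x
  proof -
    have "card (V x) = (\<Prod>i<d. card {real_of_int \<lfloor>x i / \<sigma>\<rfloor>, real_of_int \<lfloor>x i / \<sigma>\<rfloor> + 1})"
      unfolding V_def by (rule card_PiE) simp
    then show ?thesis by (simp add: numeral_2_eq_2)
  qed
  have Vgrid: "V x \<subseteq> int_grid d" for x unfolding V_def int_grid_def by (intro PiE_mono) auto
  have \<beta>pos: "\<bar>x i / \<sigma> - v i\<bar> < 1" if "\<beta> v x \<noteq> 0" "i < d" for v x i
    using that by (intro hatsupp) (auto simp: \<beta>_def)
  have \<beta>V: "v \<in> V x" if v: "v \<in> int_grid d" and "\<beta> v x \<noteq> 0" for v x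
  proof -
    have "v i \<in> {real_of_int \<lfloor>x i / \<sigma>\<rfloor>, real_of_int \<lfloor>x i / \<sigma>\<rfloor> + 1}" if i: "i < d" for i
    proof -
      obtain k where k: "v i = real_of_int k" using v i by (auto simp: int_grid_def PiE_def Pi_def Ints_def)
      have "k = \<lfloor>x i / \<sigma>\<rfloor> \<or> k = \<lfloor>x i / \<sigma>\<rfloor> + 1"
        using \<beta>pos[OF \<open>\<beta> v x \<noteq> 0\<close> i] unfolding k by linarith
      then show ?thesis using k by auto
    qed
    then show ?thesis using v by (auto simp: V_def int_grid_def PiE_def)
  qed
  have \<beta>sum: "(\<Sum>v\<in>V x. \<beta> v x) = 1" for x
  proof -
    have "(\<Sum>v\<in>V x. \<beta> v x) =
        (\<Prod>i<d. \<Sum>t\<in>{real_of_int \<lfloor>x i / \<sigma>\<rfloor>, real_of_int \<lfloor>x i / \<sigma>\<rfloor> + 1}. hat (x i / \<sigma> - t))"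
      unfolding V_def \<beta>_def by (rule prod_sum_PiE[symmetric]) auto
    also have "\<dots> = 1" by (intro prod.neutral) (simp add: hatsum)
    finally show ?thesis .
  qed
  have supp: "e ` {n. \<beta> (e n) x \<noteq> 0} \<subseteq> V x" for x using \<beta>V emem by auto
  have inj: "inj_on e S" for S using e by (meson bij_betw_def inj_on_subset subset_UNIV)
  have "atlas d \<sigma> (real d) (2 ^ d) (\<lambda>_. \<sigma>) (\<lambda>n. \<lambda>i\<in>{..<d}. \<sigma> * e n i) (\<lambda>n. \<beta> (e n))"
    unfolding atlas_def
  proof (intro conjI allI ballI impI)
    show "1 \<le> \<sigma>" using \<sigma> by simp
    show "(\<lambda>i\<in>{..<d}. \<sigma> * e n i) \<in> int_grid d" for n
      using emem[of n] by (auto simp: int_grid_def PiE_def Pi_def)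
    show "if \<sigma> = 0 then (\<lambda>i\<in>{..<d}. \<sigma> * e n i) = grid_origin d else \<sigma> = \<sigma>" for n using \<sigma> by simp
  next
    fix x
    let ?S = "{n. \<beta> (e n) x \<noteq> 0}"
    show "finite ?S" using finite_imageD[OF finite_subset[OF supp Vfin] inj] .
    have "card ?S = card (e ` ?S)" by (rule card_image[OF inj, symmetric])
    also have "\<dots> \<le> card (V x)" by (rule card_mono[OF Vfin supp])
    finally show "card ?S \<le> 2 ^ d" using Vcard[of x] by simp
    have "(\<Sum>n\<in>?S. \<beta> (e n) x) = (\<Sum>v\<in>e ` ?S. \<beta> v x)" by (simp add: sum.reindex[OF inj])
    also have "\<dots> = (\<Sum>v\<in>V x. \<beta> v x)"
    proof (intro sum.mono_neutral_left Vfin supp ballI)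
      fix v assume v: "v \<in> V x - e ` ?S"
      then have "v \<in> int_grid d" using Vgrid by auto
      then obtain n where "v = e n" using e by (auto simp: bij_betw_def)
      then show "\<beta> v x = 0" using v by auto
    qed
    also have "\<dots> = 1" by (rule \<beta>sum)
    finally show "(\<Sum>n\<in>?S. \<beta> (e n) x) = 1" .
  next
    fix n x
    show "\<bar>\<beta> (e n) x\<bar> \<le> 1"
      unfolding \<beta>_def using hat01 by (simp add: abs_prod prod_le_1)
    show "sup_dist d x (\<lambda>i\<in>{..<d}. \<sigma> * e n i) \<le> real \<sigma>" if "\<beta> (e n) x \<noteq> 0"
      unfolding sup_dist_le_iff
    proof (intro conjI allI impI)
      fix i assume i: "i < d"
      have "\<bar>x i - \<sigma> * e n i\<bar> = \<sigma> * \<bar>x i / \<sigma> - e n i\<bar>"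
        using \<sigma> by (simp add: abs_mult_pos' right_diff_distrib)
      also have "\<dots> \<le> real \<sigma> * 1" using \<beta>pos[OF that i] by (intro mult_left_mono) auto
      finally show "\<bar>x i - (\<lambda>i\<in>{..<d}. \<sigma> * e n i) i\<bar> \<le> real \<sigma>" using i by simp
    qed simp
    fix y
    have "\<bar>\<beta> (e n) x - \<beta> (e n) y\<bar> \<le> (\<Sum>i<d. \<bar>hat (x i / \<sigma> - e n i) - hat (y i / \<sigma> - e n i)\<bar>)"
      unfolding \<beta>_def real_norm_def[symmetric] using hat01
      by (intro norm_prod_diff) (simp_all add: abs_le_iff)
    also have "\<dots> \<le> (\<Sum>i<d. sup_dist d x y / \<sigma>)"
    proof (intro sum_mono)
      fix i assume "i \<in> {..<d}"
      then have "\<bar>x i - y i\<bar> / \<sigma> \<le> sup_dist d x y / \<sigma>" by (intro divide_right_mono sup_dist_ge) auto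
      moreover have "\<bar>(x i / \<sigma> - e n i) - (y i / \<sigma> - e n i)\<bar> = \<bar>x i - y i\<bar> / \<sigma>"
        using \<sigma> by (simp flip: diff_divide_distrib)
      ultimately show "\<bar>hat (x i / \<sigma> - e n i) - hat (y i / \<sigma> - e n i)\<bar> \<le> sup_dist d x y / \<sigma>"
        using hatlip[of "x i / \<sigma> - e n i" "y i / \<sigma> - e n i"] by linarith
    qed
    finally show "\<bar>\<beta> (e n) x - \<beta> (e n) y\<bar> \<le> real d / real \<sigma> * sup_dist d x y" by simp
  qed
  then show ?thesis by blast
qed

lemma atlas_exists:
  assumes "d \<ge> 1"
  shows "\<exists>s c \<psi>. atlas d \<sigma> (6 + real d) (2 + 2 ^ d) s c \<psi>"
proof (cases "\<sigma> = 0")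
  case True
  obtain s c \<psi> where "atlas d 0 6 2 s c \<psi>" using atlas_annuli by blast
  then have "atlas d \<sigma> (6 + real d) (2 + 2 ^ d) s c \<psi>" unfolding True by (rule atlas_mono) auto
  then show ?thesis by blast
next
  case False
  then obtain s c \<psi> where "atlas d \<sigma> (real d) (2 ^ d) s c \<psi>" using atlas_cubes[OF assms] by blast
  then have "atlas d \<sigma> (6 + real d) (2 + 2 ^ d) s c \<psi>" by (rule atlas_mono) auto
  then show ?thesis by blast
qed


section \<open>Spreading countably many local functions over the integer grid\<close>

text \<open>
  The condition on the function attached to a layer of scale \<open>\<sigma>\<close>, where \<open>\<sigma> = 0\<close> means that the
  scale is infinite.
\<close>

definition layer_fun :: "nat \<Rightarrow> nat \<Rightarrow> real \<Rightarrow> ((nat \<Rightarrow> real) \<Rightarrow> real) \<Rightarrow> bool" where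
  "layer_fun d \<sigma> L g \<longleftrightarrow> lip_le (int_grid d) (sup_dist d) L g \<and>
     (if \<sigma> = 0 then g (grid_origin d) = 0 else \<forall>x\<in>int_grid d. \<bar>g x\<bar> \<le> L * real \<sigma>)"

text \<open>
  The bound is needed on the cube of twice the radius, where the spread functions may be nonzero.
\<close>

lemma atlas_layer_fun_bound:
  assumes at: "atlas d \<sigma> K N s c \<psi>" and g: "layer_fun d \<sigma> L g" and L: "0 \<le> L"
    and x: "x \<in> int_grid d" "sup_dist d x (c n) \<le> 2 * real (s n)"
  shows "\<bar>g x\<bar> \<le> 2 * L * real (s n)"
proof (cases "\<sigma> = 0")
  case True
  have "\<bar>g x - g (grid_origin d)\<bar> \<le> L * sup_dist d x (grid_origin d)"
    using g x(1) grid_origin_mem by (auto simp: layer_fun_def lip_le_def)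
  also have "\<dots> \<le> L * (2 * real (s n))"
    using at x(2) L True by (intro mult_left_mono) (auto simp: atlas_def)
  finally show ?thesis using g True by (simp add: layer_fun_def mult_ac)
next
  case False
  then have "s n = \<sigma>" using at by (auto simp: atlas_def)
  then have "\<bar>g x\<bar> \<le> L * real (s n)" using g x(1) False by (auto simp: layer_fun_def)
  also have "\<dots> \<le> 2 * L * real (s n)" using L by simp
  finally show ?thesis .
qed

text \<open>
  Countably many layers \<open>l \<in> \<Lambda>\<close>, each a copy of \<open>\<int>\<^sup>d\<close> with an atlas of scale \<open>\<sigma> l\<close>. All cubes of all
  atlases are moved to pairwise distant places of one single copy of \<open>\<int>\<^sup>d\<close>.
\<close>

locale layers =
  fixes d :: nat and K :: real and N :: nat and \<Lambda> :: "'l set" and \<sigma> :: "'l \<Rightarrow> nat"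
    and s :: "'l \<Rightarrow> nat \<Rightarrow> nat" and c :: "'l \<Rightarrow> nat \<Rightarrow> nat \<Rightarrow> real"
    and \<psi> :: "'l \<Rightarrow> nat \<Rightarrow> (nat \<Rightarrow> real) \<Rightarrow> real"
  assumes d: "d \<ge> 1" and K: "0 \<le> K" and \<Lambda>: "countable \<Lambda>" "\<Lambda> \<noteq> {}"
    and atlas: "\<And>l. l \<in> \<Lambda> \<Longrightarrow> atlas d (\<sigma> l) K N (s l) (c l) (\<psi> l)"
begin

text \<open>
  The cubes are numbered by \<open>j\<close>; the cube \<open>code l n\<close> is the cube \<open>n\<close> of the layer \<open>l\<close>. Numbers
  without a preimage under \<open>code\<close> repeat cubes and do no harm.
\<close>

definition lay :: "nat \<Rightarrow> 'l" where "lay j = from_nat_into \<Lambda> (fst (prod_decode j))"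
definition num :: "nat \<Rightarrow> nat" where "num j = snd (prod_decode j)"
definition code :: "'l \<Rightarrow> nat \<Rightarrow> nat" where "code l n = prod_encode (to_nat_on \<Lambda> l, n)"

definition size :: "nat \<Rightarrow> nat" where "size j = s (lay j) (num j)"
definition centre :: "nat \<Rightarrow> nat \<Rightarrow> real" where "centre j = c (lay j) (num j)"

text \<open>
  The cube \<open>j\<close> is translated by \<open>fwd j\<close> to the centre \<open>place j\<close> on the first coordinate axis. The
  positions \<open>pos\<close> are such that cubes of twice the radius around the new centres do not overlap.
\<close>

definition pos :: "nat \<Rightarrow> real" where "pos j = 4 * (\<Sum>i\<le>j. real (size i)) - 2 * real (size j)"
definition place :: "nat \<Rightarrow> nat \<Rightarrow> real" where
  "place j = (\<lambda>i\<in>{..<d}. if i = 0 then pos j else 0)"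
definition fwd :: "nat \<Rightarrow> (nat \<Rightarrow> real) \<Rightarrow> nat \<Rightarrow> real" where
  "fwd j x = (\<lambda>i\<in>{..<d}. x i - centre j i + place j i)"
definition bwd :: "nat \<Rightarrow> (nat \<Rightarrow> real) \<Rightarrow> nat \<Rightarrow> real" where
  "bwd j z = (\<lambda>i\<in>{..<d}. z i - place j i + centre j i)"

text \<open>A point at distance \<open>2 * size j\<close> from \<open>place j\<close>, where all spread functions vanish.\<close>

definition gap :: "nat \<Rightarrow> nat \<Rightarrow> real" where
  "gap j = (\<lambda>i\<in>{..<d}. if i = 0 then pos j + 2 * real (size j) else 0)"

text \<open>The cutoff is \<open>1\<close> on the translated cube and \<open>0\<close> outside of the cube of twice its radius.\<close>

definition cut :: "nat \<Rightarrow> (nat \<Rightarrow> real) \<Rightarrow> real" where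
  "cut j z = max 0 (min 1 (2 - sup_dist d z (place j) / real (size j)))"

text \<open>
  \<open>spread\<close> writes the functions of all layers, cube by cube, on one copy of \<open>\<int>\<^sup>d\<close>, and \<open>collect\<close>
  reads the function of the layer \<open>l\<close> back with the help of the partition of unity. Reading subtracts
  the value at \<^const>\<open>gap\<close>, which makes the function that is read small on its cube, as needed for
  the product with \<open>\<psi>\<close> to be Lipschitz.
\<close>

definition spread :: "('l \<Rightarrow> (nat \<Rightarrow> real) \<Rightarrow> real) \<Rightarrow> (nat \<Rightarrow> real) \<Rightarrow> real" where
  "spread g z = (\<Sum>j | cut j z \<noteq> 0. cut j z * g (lay j) (bwd j z))"

definition collect :: "((nat \<Rightarrow> real) \<Rightarrow> real) \<Rightarrow> 'l \<Rightarrow> (nat \<Rightarrow> real) \<Rightarrow> real" where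
  "collect F l x = (\<Sum>n | \<psi> l n x \<noteq> 0. \<psi> l n x * (F (fwd (code l n) x) - F (gap (code l n))))"

lemma lay_mem: "lay j \<in> \<Lambda>"
  unfolding lay_def by (rule from_nat_into[OF \<Lambda>(2)])

lemma lay_code [simp]: "l \<in> \<Lambda> \<Longrightarrow> lay (code l n) = l" and num_code [simp]: "num (code l n) = n"
  using \<Lambda> by (simp_all add: lay_def num_def code_def)

lemma size_code [simp]: "l \<in> \<Lambda> \<Longrightarrow> size (code l n) = s l n"
  and centre_code [simp]: "l \<in> \<Lambda> \<Longrightarrow> centre (code l n) = c l n"
  by (simp_all add: size_def centre_def)

lemma size_pos: "1 \<le> size j"
  using atlas[OF lay_mem] by (auto simp: size_def atlas_def)

lemma centre_mem: "centre j \<in> int_grid d"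
  using atlas[OF lay_mem] by (auto simp: centre_def atlas_def)

lemma pos_Ints: "pos j \<in> \<int>"
  unfolding pos_def by (intro Ints_diff Ints_mult Ints_sum) auto

lemma place_mem: "place j \<in> int_grid d" and gap_mem: "gap j \<in> int_grid d"
  using pos_Ints by (auto simp: place_def gap_def int_grid_def)

lemma fwd_mem: "x \<in> int_grid d \<Longrightarrow> fwd j x \<in> int_grid d"
  and bwd_mem: "z \<in> int_grid d \<Longrightarrow> bwd j z \<in> int_grid d"
  using place_mem[of j] centre_mem[of j] by (auto simp: fwd_def bwd_def int_grid_def PiE_def Pi_def)

lemma bwd_fwd: "x \<in> int_grid d \<Longrightarrow> bwd j (fwd j x) = x"
  by (auto simp: fwd_def bwd_def int_grid_def PiE_def restrict_def extensional_def fun_eq_iff)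

lemma sup_dist_fwd: "sup_dist d (fwd j x) (fwd j y) = sup_dist d x y"
  and sup_dist_bwd: "sup_dist d (bwd j x) (bwd j y) = sup_dist d x y"
  and sup_dist_fwd_place: "sup_dist d (fwd j x) (place j) = sup_dist d x (centre j)"
  and sup_dist_bwd_centre: "sup_dist d (bwd j x) (centre j) = sup_dist d x (place j)"
  by (intro sup_dist_cong; simp add: fwd_def bwd_def)+

lemma sup_dist_axis:
  "sup_dist d (\<lambda>i\<in>{..<d}. if i = 0 then a else 0) (\<lambda>i\<in>{..<d}. if i = 0 then b else 0) = \<bar>a - b\<bar>"
proof (rule antisym)
  show "sup_dist d (\<lambda>i\<in>{..<d}. if i = 0 then a else 0) (\<lambda>i\<in>{..<d}. if i = 0 then b else 0) \<le> \<bar>a - b\<bar>"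
    by (auto simp: sup_dist_le_iff)
  show "\<bar>a - b\<bar> \<le> sup_dist d (\<lambda>i\<in>{..<d}. if i = 0 then a else 0) (\<lambda>i\<in>{..<d}. if i = 0 then b else 0)"
    using sup_dist_ge[of 0 d "\<lambda>i\<in>{..<d}. if i = 0 then a else 0" "\<lambda>i\<in>{..<d}. if i = 0 then b else 0"] d
    by simp
qed

lemma pos_separated:
  assumes "j \<noteq> k"
  shows "2 * real (size j) + 2 * real (size k) \<le> \<bar>pos j - pos k\<bar>"
proof -
  have *: "2 * real (size j) + 2 * real (size k) \<le> pos k - pos j" if "j < k" for j k
  proof -
    have "(\<Sum>i\<le>k. real (size i)) = (\<Sum>i\<le>j. real (size i)) + (\<Sum>i\<in>{j<..k}. real (size i))"
      using that by (subst sum.union_disjoint[symmetric]) (auto intro!: sum.cong)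
    moreover have "real (size k) \<le> (\<Sum>i\<in>{j<..k}. real (size i))"
      using that by (intro member_le_sum) auto
    ultimately show ?thesis by (simp add: pos_def)
  qed
  show ?thesis
    using *[of j k] *[of k j] assms by (cases "j < k") auto
qed

lemma cut01: "0 \<le> cut j z" "cut j z \<le> 1"
  by (simp_all add: cut_def)

lemma cut_supp: "cut j z \<noteq> 0 \<longleftrightarrow> sup_dist d z (place j) < 2 * real (size j)"
  using size_pos[of j] by (auto simp: cut_def max_def min_def field_simps)

lemma cut_one: "sup_dist d z (place j) \<le> real (size j) \<Longrightarrow> cut j z = 1"
  using size_pos[of j] by (auto simp: cut_def field_simps)

lemma cut_diff: "\<bar>cut j z - cut j w\<bar> \<le> 1 / real (size j) * sup_dist d z w"
proof -
  have "\<bar>cut j z - cut j w\<bar> \<le>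
      \<bar>sup_dist d z (place j) / real (size j) - sup_dist d w (place j) / real (size j)\<bar>"
    unfolding cut_def by linarith
  also have "\<dots> = \<bar>sup_dist d z (place j) - sup_dist d w (place j)\<bar> / real (size j)"
    by (simp flip: diff_divide_distrib)
  also have "\<dots> \<le> sup_dist d z w / real (size j)"
    by (intro divide_right_mono sup_dist_diff_le) simp
  finally show ?thesis by simp
qed

lemma cut_disjoint:
  assumes "cut j z \<noteq> 0" "cut k z \<noteq> 0"
  shows "j = k"
proof (rule ccontr)
  assume "j \<noteq> k"
  then have "2 * real (size j) + 2 * real (size k) \<le> sup_dist d (place j) (place k)"
    unfolding place_def sup_dist_axis by (rule pos_separated)
  also have "\<dots> \<le> sup_dist d z (place j) + sup_dist d z (place k)"
    using sup_dist_triangle[of d "place j" "place k" z] sup_dist_commute[of d "place j" z] by simp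
  finally show False using assms unfolding cut_supp by linarith
qed

lemma cut_gap: "cut k (gap j) = 0"
proof (rule ccontr)
  assume "cut k (gap j) \<noteq> 0"
  then have *: "\<bar>pos j + 2 * real (size j) - pos k\<bar> < 2 * real (size k)"
    unfolding cut_supp gap_def place_def sup_dist_axis .
  then have "j \<noteq> k" by auto
  then show False using pos_separated[of j k] * by linarith
qed

lemma cut_active: "finite {j. cut j z \<noteq> 0}" "card {j. cut j z \<noteq> 0} \<le> 1"
proof -
  have "\<exists>j. {j. cut j z \<noteq> 0} \<subseteq> {j}" using cut_disjoint[of _ z] by blast
  then obtain j where j: "{j. cut j z \<noteq> 0} \<subseteq> {j}" by blast
  show "finite {j. cut j z \<noteq> 0}" by (rule finite_subset[OF j]) simp
  show "card {j. cut j z \<noteq> 0} \<le> 1" using card_mono[OF _ j] by simp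
qed

lemma spread_gap: "spread g (gap j) = 0"
  by (simp add: spread_def cut_gap)

lemma spread_lip:
  assumes g: "\<And>l. l \<in> \<Lambda> \<Longrightarrow> layer_fun d (\<sigma> l) L (g l)" and L: "0 \<le> L"
  shows "lip_le (int_grid d) (sup_dist d) (6 * L) (spread g)"
  unfolding lip_le_def
proof (intro ballI)
  fix z w assume z: "z \<in> int_grid d" and w: "w \<in> int_grid d"
  let ?\<delta> = "sup_dist d z w"
  have bd: "\<bar>g (lay j) (bwd j v)\<bar> \<le> 2 * L * real (size j)" if "cut j v \<noteq> 0" "v \<in> int_grid d" for j v
    unfolding size_def
    by (rule atlas_layer_fun_bound[OF atlas[OF lay_mem] g[OF lay_mem] L bwd_mem[OF that(2)]])
      (use that(1) sup_dist_bwd_centre[of j v] in \<open>simp add: cut_supp centre_def size_def\<close>)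
  have "\<bar>cut j z * g (lay j) (bwd j z) - cut j w * g (lay j) (bwd j w)\<bar> \<le> (1 * (2 * L) + L) * ?\<delta>" for j
  proof (rule bump_mult_diff_le[OF _ _ cut_diff])
    show "\<bar>g (lay j) (bwd j z) - g (lay j) (bwd j w)\<bar> \<le> L * ?\<delta>"
      using g[OF lay_mem[of j]] bwd_mem[OF z, of j] bwd_mem[OF w, of j]
      by (auto simp: layer_fun_def lip_le_def simp flip: sup_dist_bwd[of j z w])
  qed (use cut01[of j] size_pos[of j] bd z w L sup_dist_nonneg in auto)
  then have "\<bar>spread g z - spread g w\<bar> \<le> 2 * real 1 * ((1 * (2 * L) + L) * ?\<delta>)"
    unfolding spread_def using L sup_dist_nonneg[of d z w]
    by (intro sum_active_diff_le cut_active) auto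
  then show "\<bar>spread g z - spread g w\<bar> \<le> 6 * L * ?\<delta>" by (simp add: algebra_simps)
qed

lemma collect_term_bound:
  assumes F: "lip_le (int_grid d) (sup_dist d) L F" and L: "0 \<le> L" and l: "l \<in> \<Lambda>"
    and x: "x \<in> int_grid d" and act: "\<psi> l n x \<noteq> 0"
  shows "\<bar>F (fwd (code l n) x) - F (gap (code l n))\<bar> \<le> 3 * L * real (s l n)"
proof -
  let ?j = "code l n"
  have "sup_dist d (fwd ?j x) (gap ?j) \<le> sup_dist d (fwd ?j x) (place ?j) + sup_dist d (place ?j) (gap ?j)"
    by (rule sup_dist_triangle)
  also have "sup_dist d (fwd ?j x) (place ?j) \<le> real (s l n)"
    using atlas[OF l] x act l by (simp add: sup_dist_fwd_place atlas_def)
  also have "sup_dist d (place ?j) (gap ?j) = 2 * real (s l n)"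
    unfolding place_def gap_def sup_dist_axis using l by simp
  finally have *: "sup_dist d (fwd ?j x) (gap ?j) \<le> 3 * real (s l n)" by simp
  have "\<bar>F (fwd ?j x) - F (gap ?j)\<bar> \<le> L * sup_dist d (fwd ?j x) (gap ?j)"
    by (rule lip_leD[OF F fwd_mem[OF x] gap_mem])
  also have "\<dots> \<le> L * (3 * real (s l n))" by (rule mult_left_mono[OF * L])
  finally show ?thesis by (simp add: mult_ac)
qed

lemma collect_lip:
  assumes F: "lip_le (int_grid d) (sup_dist d) L F" and L: "0 \<le> L" and l: "l \<in> \<Lambda>"
  shows "lip_le (int_grid d) (sup_dist d) (2 * real N * (3 * K + 1) * L) (collect F l)"
  unfolding lip_le_def
proof (intro ballI)
  fix x y assume x: "x \<in> int_grid d" and y: "y \<in> int_grid d"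
  let ?\<delta> = "sup_dist d x y"
  let ?G = "\<lambda>n x. F (fwd (code l n) x) - F (gap (code l n))"
  have "\<bar>\<psi> l n x * ?G n x - \<psi> l n y * ?G n y\<bar> \<le> (K * (3 * L) + L) * ?\<delta>" for n
  proof (rule bump_mult_diff_le)
    show "\<bar>\<psi> l n x\<bar> \<le> 1" "\<bar>\<psi> l n y\<bar> \<le> 1" "\<bar>\<psi> l n x - \<psi> l n y\<bar> \<le> K / real (s l n) * ?\<delta>"
      "0 < real (s l n)"
      using atlas[OF l] x y unfolding atlas_def by (fastforce simp: Suc_le_eq)+
    show "\<bar>?G n x - ?G n y\<bar> \<le> L * ?\<delta>"
      using lip_leD[OF F fwd_mem[OF x, of "code l n"] fwd_mem[OF y, of "code l n"]]
      by (simp add: sup_dist_fwd)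
  qed (use collect_term_bound[OF F L l x] collect_term_bound[OF F L l y] L K sup_dist_nonneg in auto)
  then have "\<bar>collect F l x - collect F l y\<bar> \<le> 2 * real N * ((K * (3 * L) + L) * ?\<delta>)"
    unfolding collect_def using atlas[OF l] x y L K sup_dist_nonneg[of d x y]
    by (intro sum_active_diff_le) (auto simp: atlas_def)
  then show "\<bar>collect F l x - collect F l y\<bar> \<le> 2 * real N * (3 * K + 1) * L * ?\<delta>"
    by (simp add: algebra_simps)
qed

lemma collect_bound:
  assumes F: "lip_le (int_grid d) (sup_dist d) L F" and L: "0 \<le> L" and l: "l \<in> \<Lambda>"
    and x: "x \<in> int_grid d" and \<sigma>: "\<sigma> l \<noteq> 0"
  shows "\<bar>collect F l x\<bar> \<le> 3 * real N * L * real (\<sigma> l)"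
proof -
  have s: "s l n = \<sigma> l" for n using atlas[OF l] \<sigma> by (auto simp: atlas_def)
  have "\<bar>collect F l x\<bar> \<le> (\<Sum>n | \<psi> l n x \<noteq> 0. \<bar>\<psi> l n x * (F (fwd (code l n) x) - F (gap (code l n)))\<bar>)"
    unfolding collect_def by (rule sum_abs)
  also have "\<dots> \<le> real (card {n. \<psi> l n x \<noteq> 0}) * (1 * (3 * L * real (\<sigma> l)))"
  proof (rule sum_bounded_above)
    fix n assume "n \<in> {n. \<psi> l n x \<noteq> 0}"
    then have "\<bar>F (fwd (code l n) x) - F (gap (code l n))\<bar> \<le> 3 * L * real (\<sigma> l)"
      using collect_term_bound[OF F L l x] s by simp
    moreover have "\<bar>\<psi> l n x\<bar> \<le> 1" using atlas[OF l] x by (auto simp: atlas_def)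
    ultimately show "\<bar>\<psi> l n x * (F (fwd (code l n) x) - F (gap (code l n)))\<bar> \<le> 1 * (3 * L * real (\<sigma> l))"
      unfolding abs_mult by (intro mult_mono) auto
  qed
  also have "\<dots> \<le> real N * (1 * (3 * L * real (\<sigma> l)))"
    using atlas[OF l] x L by (intro mult_right_mono) (auto simp: atlas_def)
  finally show ?thesis by (simp add: mult_ac)
qed

lemma collect_spread:
  assumes l: "l \<in> \<Lambda>" and x: "x \<in> int_grid d"
  shows "collect (spread g) l x = g l x"
proof -
  have "collect (spread g) l x = (\<Sum>n | \<psi> l n x \<noteq> 0. \<psi> l n x * g l x)"
    unfolding collect_def
  proof (rule sum.cong[OF refl])
    fix n assume "n \<in> {n. \<psi> l n x \<noteq> 0}"
    then have "sup_dist d x (c l n) \<le> real (s l n)" using atlas[OF l] x by (auto simp: atlas_def)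
    then have 1: "cut (code l n) (fwd (code l n) x) = 1"
      using l by (intro cut_one) (simp add: sup_dist_fwd_place)
    then have "{j. cut j (fwd (code l n) x) \<noteq> 0} = {code l n}"
      using cut_disjoint[of _ "fwd (code l n) x" "code l n"] by auto
    then have "spread g (fwd (code l n) x) = g l x"
      using 1 l x by (simp add: spread_def bwd_fwd)
    then show "\<psi> l n x * (spread g (fwd (code l n) x) - spread g (gap (code l n))) = \<psi> l n x * g l x"
      by (simp add: spread_gap)
  qed
  also have "\<dots> = (\<Sum>n | \<psi> l n x \<noteq> 0. \<psi> l n x) * g l x" by (simp add: sum_distrib_right)
  also have "\<dots> = g l x" using atlas[OF l] x by (simp add: atlas_def)
  finally show ?thesis .
qed

lemma collect_const: "collect (\<lambda>z. F z - a) l x = collect F l x"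
  by (simp add: collect_def)

lemma collect_span:
  assumes x: "x \<in> int_grid d"
  shows "(\<lambda>F. collect F l x) \<in> span (ev ` int_grid d)"
proof -
  have "(\<lambda>F. collect F l x) =
      (\<Sum>n | \<psi> l n x \<noteq> 0. \<psi> l n x *\<^sub>R (ev (fwd (code l n) x) - ev (gap (code l n))))"
    by (rule ext) (simp add: collect_def ev_def sum_fun_apply)
  also have "\<dots> \<in> span (ev ` int_grid d)"
    using fwd_mem[OF x] gap_mem by (intro span_sum span_scale span_diff span_base) auto
  finally show ?thesis .
qed

lemma spread_span:
  assumes z: "z \<in> int_grid d"
    and G: "\<And>l x. l \<in> \<Lambda> \<Longrightarrow> x \<in> int_grid d \<Longrightarrow> (\<lambda>f. G f l x) \<in> span V"
  shows "(\<lambda>f. spread (G f) z) \<in> span V"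
proof -
  have "(\<lambda>f. spread (G f) z) = (\<Sum>j | cut j z \<noteq> 0. cut j z *\<^sub>R (\<lambda>f. G f (lay j) (bwd j z)))"
    by (rule ext) (simp add: spread_def sum_fun_apply)
  also have "\<dots> \<in> span V"
    using G[OF lay_mem bwd_mem[OF z]] by (intro span_sum span_scale)
  finally show ?thesis .
qed

end


section \<open>The layers of the geometric grid\<close>

text \<open>The range of the geometric coordinates; it begins with \<open>1 + \<epsilon>\<close>.\<close>

definition geo :: "real \<Rightarrow> real set" where
  "geo \<epsilon> = {(1 + \<epsilon>) ^ m |m. 1 \<le> m}"

text \<open>
  The geometric coordinates of a point of \<^const>\<open>int_geo_grid\<close>, which have the indices
  \<open>d, \<dots>, d + q - 1\<close>.
\<close>

definition geo_grid :: "real \<Rightarrow> nat \<Rightarrow> nat \<Rightarrow> (nat \<Rightarrow> real) set" where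
  "geo_grid \<epsilon> d q = {d..<d + q} \<rightarrow>\<^sub>E geo \<epsilon>"

text \<open>The point with integer coordinates \<open>x\<close> and geometric coordinates \<open>u\<close>.\<close>

definition join :: "nat \<Rightarrow> (nat \<Rightarrow> real) \<Rightarrow> (nat \<Rightarrow> real) \<Rightarrow> nat \<Rightarrow> real" where
  "join d x u = (\<lambda>i. if i < d then x i else u i)"

text \<open>
  The layer \<open>None\<close> carries the values of a function on the bottom copy of \<open>\<int>\<^sup>d\<close>, and the layer
  \<open>Some (\<theta>, u)\<close> its increments when the geometric coordinates of \<open>u\<close> that are at most \<open>\<theta>\<close> drop to
  the least value \<open>1 + \<epsilon>\<close>.
\<close>

definition geo_layers :: "real \<Rightarrow> nat \<Rightarrow> nat \<Rightarrow> (real \<times> (nat \<Rightarrow> real)) option set" where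
  "geo_layers \<epsilon> d q = insert None (Some ` (geo \<epsilon> \<times> geo_grid \<epsilon> d q))"

text \<open>The size of these increments; \<open>k = 0\<close> stands for the metric that is not truncated.\<close>

definition geo_scale :: "nat \<Rightarrow> (real \<times> (nat \<Rightarrow> real)) option \<Rightarrow> nat" where
  "geo_scale k l = (case l of None \<Rightarrow> k
     | Some (\<theta>, u) \<Rightarrow> if k = 0 then nat \<lceil>\<theta>\<rceil> else min k (nat \<lceil>\<theta>\<rceil>))"

lemma countable_geo_layers: "countable (geo_layers \<epsilon> d q)"
proof -
  have "countable (geo \<epsilon>)" by (simp add: geo_def setcompr_eq_image)
  then show ?thesis
    unfolding geo_layers_def geo_grid_def
    by (intro countable_insert countable_image countable_SIGMA countable_PiE) auto
qed

text \<open>Removing the elements of \<open>S\<close> one by one, the smallest first.\<close>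

lemma telescope_by_size:
  fixes e :: "real set \<Rightarrow> real"
  assumes "finite S"
  shows "(\<Sum>\<theta>\<in>S. e (S \<inter> {\<theta>..}) - e (S \<inter> {\<theta><..})) = e S - e {}"
  using assms
proof (induction S rule: finite_linorder_min_induct)
  case empty
  then show ?case by simp
next
  case (insert b S)
  have "insert b S \<inter> {b..} = insert b S" "insert b S \<inter> {b<..} = S"
    using insert.hyps(2) by auto
  moreover have "insert b S \<inter> {\<theta>..} = S \<inter> {\<theta>..}" "insert b S \<inter> {\<theta><..} = S \<inter> {\<theta><..}" if "\<theta> \<in> S" for \<theta>
    using insert.hyps(2) that by auto
  moreover have "b \<notin> S" using insert.hyps(2) by auto
  ultimately show ?case using insert.IH insert.hyps(1) by simp
qed

text \<open>
  The grid \<open>M\<close> with the metric truncated at \<open>k\<close>; for \<open>k = 0\<close> this is the metric of the norm.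
\<close>

locale geometric_layers = layers d K N "geo_layers \<epsilon> d q" "geo_scale k" s c \<psi>
  for \<epsilon> :: real and d q k :: nat and K N s c \<psi> +
  assumes \<epsilon>: "\<epsilon> > 0"
begin

abbreviation "M \<equiv> int_geo_grid \<epsilon> d q"
abbreviation "\<rho> \<equiv> mdist (capped_metric (real k) (sup_metric (d + q)))"

text \<open>Geometric coordinates with values outside of \<open>S\<close> drop to the bottom value \<open>1 + \<epsilon>\<close>.\<close>

definition keep :: "real set \<Rightarrow> (nat \<Rightarrow> real) \<Rightarrow> nat \<Rightarrow> real" where
  "keep S u = (\<lambda>i\<in>{d..<d + q}. if u i \<in> S then u i else 1 + \<epsilon>)"

text \<open>The least geometric coordinates, those of the bottom copy of \<open>\<int>\<^sup>d\<close>.\<close>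

definition bottom :: "nat \<Rightarrow> real" where
  "bottom = (\<lambda>i\<in>{d..<d + q}. 1 + \<epsilon>)"

text \<open>The values of \<open>u\<close> above the bottom.\<close>

definition vals :: "(nat \<Rightarrow> real) \<Rightarrow> real set" where
  "vals u = u ` {d..<d + q} - {1 + \<epsilon>}"

abbreviation "ints p \<equiv> restrict p {..<d}"
abbreviation "geos p \<equiv> restrict p {d..<d + q}"

text \<open>The functions on the layers that belong to a function \<open>f\<close> on \<open>M\<close>.\<close>

definition increments ::
    "((nat \<Rightarrow> real) \<Rightarrow> real) \<Rightarrow> (real \<times> (nat \<Rightarrow> real)) option \<Rightarrow> (nat \<Rightarrow> real) \<Rightarrow> real" where
  "increments f l x = (case l of
     None \<Rightarrow> f (join d x bottom) - f (join d (grid_origin d) bottom)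
   | Some (\<theta>, u) \<Rightarrow> f (join d x u) - f (join d x (keep {\<theta><..} u)))"

text \<open>All increments of \<open>f\<close>, written on \<open>\<int>\<^sup>d\<close>.\<close>

definition encode :: "((nat \<Rightarrow> real) \<Rightarrow> real) \<Rightarrow> (nat \<Rightarrow> real) \<Rightarrow> real" where
  "encode f = spread (increments f)"

text \<open>
  The value at \<open>p\<close> is reassembled by raising the geometric coordinates of \<open>p\<close> from the bottom in
  order of decreasing size, one step for each element of \<^const>\<open>vals\<close>.
\<close>

definition decode :: "((nat \<Rightarrow> real) \<Rightarrow> real) \<Rightarrow> (nat \<Rightarrow> real) \<Rightarrow> real" where
  "decode F p = collect F None (ints p) +
     (\<Sum>\<theta>\<in>vals (geos p). collect F (Some (\<theta>, keep {\<theta>..} (geos p))) (ints p))"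

lemma geo_ge: "\<theta> \<in> geo \<epsilon> \<Longrightarrow> 1 + \<epsilon> \<le> \<theta>"
proof -
  assume "\<theta> \<in> geo \<epsilon>"
  then obtain m where "m \<ge> 1" "\<theta> = (1 + \<epsilon>) ^ m" by (auto simp: geo_def)
  then show ?thesis using power_increasing[of 1 m "1 + \<epsilon>"] \<epsilon> by simp
qed

lemma geo_least: "1 + \<epsilon> \<in> geo \<epsilon>"
  by (auto simp: geo_def intro!: exI[of _ 1])

text \<open>Two different elements of a geometric progression are comparable to their distance.\<close>

lemma geo_le_distance:
  assumes "a \<in> geo \<epsilon>" "b \<in> geo \<epsilon>" "a \<noteq> b"
  shows "a \<le> (1 + \<epsilon>) / \<epsilon> * \<bar>a - b\<bar>"
proof -
  have *: "(1 + \<epsilon>) ^ n \<le> (1 + \<epsilon>) / \<epsilon> * ((1 + \<epsilon>) ^ n - (1 + \<epsilon>) ^ m)" if "m < n" for m n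
  proof -
    have "(1 + \<epsilon>) * (1 + \<epsilon>) ^ m \<le> (1 + \<epsilon>) ^ n"
      using that \<epsilon> power_increasing[of "Suc m" n "1 + \<epsilon>"] by simp
    then show ?thesis using \<epsilon> by (simp add: field_simps)
  qed
  obtain m n where mn: "a = (1 + \<epsilon>) ^ m" "b = (1 + \<epsilon>) ^ n" using assms by (auto simp: geo_def)
  consider "m < n" | "n < m" using assms mn by force
  then show ?thesis
  proof cases
    case 1
    then have "a < b" using mn \<epsilon> by simp
    then show ?thesis using *[OF 1] mn by simp
  next
    case 2
    then have "b < a" using mn \<epsilon> by simp
    then show ?thesis using *[OF 2] mn by simp
  qed
qed

lemma mem_M_iff: "p \<in> M \<longleftrightarrow> ints p \<in> int_grid d \<and> geos p \<in> geo_grid \<epsilon> d q \<and> p \<in> extensional {..<d + q}"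
  by (auto simp: int_geo_grid_def int_grid_def geo_grid_def geo_def PiE_def Pi_def)

lemma join_mem: "x \<in> int_grid d \<Longrightarrow> u \<in> geo_grid \<epsilon> d q \<Longrightarrow> join d x u \<in> M"
  by (auto simp: int_geo_grid_def int_grid_def geo_grid_def geo_def join_def PiE_def Pi_def extensional_def)

lemma join_ints_geos: "p \<in> M \<Longrightarrow> join d (ints p) (geos p) = p"
  by (auto simp: int_geo_grid_def join_def PiE_def extensional_def fun_eq_iff)

lemma keep_mem: "u \<in> geo_grid \<epsilon> d q \<Longrightarrow> keep S u \<in> geo_grid \<epsilon> d q"
  using geo_least by (auto simp: geo_grid_def keep_def)

lemma bottom_mem: "bottom \<in> geo_grid \<epsilon> d q"
  using geo_least by (auto simp: geo_grid_def bottom_def)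

lemma vals_geo: "u \<in> geo_grid \<epsilon> d q \<Longrightarrow> vals u \<subseteq> geo \<epsilon>"
  by (auto simp: vals_def geo_grid_def)

lemma finite_vals: "finite (vals u)" and card_vals: "card (vals u) \<le> q"
proof -
  show "finite (vals u)" by (simp add: vals_def)
  have "card (vals u) \<le> card (u ` {d..<d + q})" unfolding vals_def by (intro card_mono) auto
  also have "\<dots> \<le> card {d..<d + q}" by (intro card_image_le) simp
  finally show "card (vals u) \<le> q" by simp
qed

lemma keep_vals: "u \<in> geo_grid \<epsilon> d q \<Longrightarrow> keep (vals u) u = u"
  by (auto simp: keep_def vals_def geo_grid_def fun_eq_iff restrict_def PiE_def extensional_def)

lemma keep_empty: "keep {} u = bottom"
  by (simp add: keep_def bottom_def)

lemma keep_inter_vals: "keep (vals u \<inter> S) u = keep S u"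
  by (auto simp: keep_def vals_def restrict_def fun_eq_iff)

lemma keep_keep: "keep {\<theta><..} (keep {\<theta>..} u) = keep {\<theta><..} u"
  by (auto simp: keep_def restrict_def fun_eq_iff)

lemma rho_le: "\<rho> p p' \<le> sup_dist (d + q) p p'"
  by (simp add: capped_metric_mdist)

lemma rho_le_k: "k \<noteq> 0 \<Longrightarrow> \<rho> p p' \<le> real k"
  by (simp add: capped_metric_mdist)

lemma sup_dist_join_left: "sup_dist (d + q) (join d x u) (join d y u) \<le> sup_dist d x y"
  by (auto simp: sup_dist_le_iff join_def sup_dist_nonneg intro: sup_dist_ge)

lemma sup_dist_join_keep:
  assumes "u \<in> geo_grid \<epsilon> d q" "0 \<le> \<theta>"
  shows "sup_dist (d + q) (join d x u) (join d x (keep {\<theta><..} u)) \<le> \<theta>"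
  unfolding sup_dist_le_iff
proof (intro conjI allI impI)
  fix i assume i: "i < d + q"
  show "\<bar>join d x u i - join d x (keep {\<theta><..} u) i\<bar> \<le> \<theta>"
  proof (cases "i < d")
    case True
    then show ?thesis using assms(2) by (simp add: join_def)
  next
    case False
    then have "1 + \<epsilon> \<le> u i" using i assms(1) by (intro geo_ge) (auto simp: geo_grid_def)
    then show ?thesis using False i assms(2) \<epsilon> by (auto simp: join_def keep_def)
  qed
qed (rule assms(2))

text \<open>
  Coordinates that are at most \<open>\<theta>\<close> drop by less than \<open>\<theta>\<close>, so the increment is bounded by the
  Lipschitz constant times \<open>\<theta>\<close>.
\<close>

lemma layer_fun_increments:
  assumes f: "lip_le M \<rho> L f" and L: "0 \<le> L" and l: "l \<in> geo_layers \<epsilon> d q"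
  shows "layer_fun d (geo_scale k l) (2 * L) (increments f l)"
proof -
  have f1: "\<bar>f p - f p'\<bar> \<le> L * a" if "p \<in> M" "p' \<in> M" "\<rho> p p' \<le> a" for p p' a
    using lip_leD[OF f that(1,2)] mult_left_mono[OF that(3) L] by linarith
  have horizontal: "\<bar>f (join d x u) - f (join d y u)\<bar> \<le> L * sup_dist d x y"
    if "x \<in> int_grid d" "y \<in> int_grid d" "u \<in> geo_grid \<epsilon> d q" for x y u
    by (intro f1 join_mem that order_trans[OF rho_le] sup_dist_join_left)
  show ?thesis
  proof (cases l)
    case None
    have "\<bar>f (join d x bottom) - f (join d (grid_origin d) bottom)\<bar> \<le> 2 * L * real k"
      if "k \<noteq> 0" "x \<in> int_grid d" for x
      using f1[OF join_mem[OF that(2) bottom_mem] join_mem[OF grid_origin_mem bottom_mem] rho_le_k[OF that(1)]]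
        L by (simp add: mult.assoc)
    moreover have "\<bar>f (join d x bottom) - f (join d y bottom)\<bar> \<le> 2 * L * sup_dist d x y"
      if "x \<in> int_grid d" "y \<in> int_grid d" for x y
      using horizontal[OF that bottom_mem] mult_nonneg_nonneg[OF L sup_dist_nonneg[of d x y]] by linarith
    ultimately show ?thesis
      by (simp add: None layer_fun_def geo_scale_def increments_def lip_le_def)
  next
    case (Some a)
    then obtain \<theta> u where lu: "l = Some (\<theta>, u)" "\<theta> \<in> geo \<epsilon>" "u \<in> geo_grid \<epsilon> d q"
      using l by (auto simp: geo_layers_def)
    have \<theta>: "1 \<le> \<theta>" using geo_ge[OF lu(2)] \<epsilon> by linarith
    then have scale: "geo_scale k l \<noteq> 0" by (simp add: lu geo_scale_def)
    have "\<bar>increments f l x - increments f l y\<bar> \<le> 2 * L * sup_dist d x y"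
      if "x \<in> int_grid d" "y \<in> int_grid d" for x y
      using horizontal[OF that lu(3)] horizontal[OF that keep_mem[OF lu(3), of "{\<theta><..}"]]
      by (simp add: lu increments_def)
    moreover have "\<bar>increments f l x\<bar> \<le> 2 * L * real (geo_scale k l)" if x: "x \<in> int_grid d" for x
    proof -
      let ?p = "join d x u" and ?p' = "join d x (keep {\<theta><..} u)"
      have "sup_dist (d + q) ?p ?p' \<le> \<theta>" using lu \<theta> by (intro sup_dist_join_keep) auto
      also have "\<theta> \<le> real (nat \<lceil>\<theta>\<rceil>)" by (rule real_nat_ceiling_ge)
      finally have "\<rho> ?p ?p' \<le> real (geo_scale k l)"
        using rho_le[of ?p ?p'] rho_le_k[of ?p ?p'] by (auto simp: lu geo_scale_def)
      then have "\<bar>increments f l x\<bar> \<le> L * real (geo_scale k l)"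
        using f1[OF join_mem[OF x lu(3)] join_mem[OF x keep_mem[OF lu(3)]]] by (simp add: lu increments_def)
      also have "\<dots> \<le> 2 * L * real (geo_scale k l)" using L by (simp add: mult.assoc)
      finally show ?thesis .
    qed
    ultimately show ?thesis using scale by (simp add: layer_fun_def lip_le_def)
  qed
qed

lemma lip_operator_encode: "lip_operator M \<rho> (int_grid d) (sup_dist d) 12 encode"
  unfolding lip_operator_def
proof (intro conjI ballI allI impI)
  have inc: "(\<lambda>f. increments f l x) \<in> span (ev ` M)"
    if "l \<in> geo_layers \<epsilon> d q" "x \<in> int_grid d" for l x
  proof -
    have *: "(\<lambda>f. f (join d y u) - f (join d y' u')) \<in> span (ev ` M)"
      if "y \<in> int_grid d" "y' \<in> int_grid d" "u \<in> geo_grid \<epsilon> d q" "u' \<in> geo_grid \<epsilon> d q" for y y' u u'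
    proof -
      have "(\<lambda>f. f (join d y u) - f (join d y' u')) = ev (join d y u) - ev (join d y' u')"
        by (simp add: ev_def fun_eq_iff)
      also have "\<dots> \<in> span (ev ` M)" using that by (intro span_diff span_base imageI join_mem)
      finally show ?thesis .
    qed
    show ?thesis
      using that bottom_mem grid_origin_mem keep_mem
      by (auto simp: increments_def geo_layers_def intro!: *)
  qed
  show "(\<lambda>f. encode f z) \<in> span (ev ` M)" if "z \<in> int_grid d" for z
    unfolding encode_def by (rule spread_span[OF that inc])
  show "lip_le (int_grid d) (sup_dist d) (12 * L) (encode f)" if "0 \<le> L" "lip_le M \<rho> L f" for L f
    using spread_lip[of "2 * L" "increments f"] layer_fun_increments[OF that(2,1)] that(1)
    by (simp add: encode_def)
qed

lemma decode_encode:
  assumes p: "p \<in> M"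
  shows "decode (encode f) p = f p - f (join d (grid_origin d) bottom)"
proof -
  let ?x = "ints p" and ?y = "geos p"
  have x: "?x \<in> int_grid d" and y: "?y \<in> geo_grid \<epsilon> d q" using p by (simp_all add: mem_M_iff)
  define e where "e S = f (join d ?x (keep S ?y))" for S
  have "decode (encode f) p = increments f None ?x + (\<Sum>\<theta>\<in>vals ?y. increments f (Some (\<theta>, keep {\<theta>..} ?y)) ?x)"
    unfolding decode_def encode_def
    using x y vals_geo[OF y] keep_mem
    by (intro arg_cong2[of _ _ _ _ "(+)"] sum.cong collect_spread) (auto simp: geo_layers_def)
  also have "(\<Sum>\<theta>\<in>vals ?y. increments f (Some (\<theta>, keep {\<theta>..} ?y)) ?x) =
      (\<Sum>\<theta>\<in>vals ?y. e (vals ?y \<inter> {\<theta>..}) - e (vals ?y \<inter> {\<theta><..}))"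
    by (simp add: increments_def keep_keep e_def keep_inter_vals)
  also have "\<dots> = e (vals ?y) - e {}" by (rule telescope_by_size[OF finite_vals])
  also have "\<dots> = f p - f (join d ?x bottom)"
    by (simp add: e_def keep_vals[OF y] keep_empty join_ints_geos[OF p])
  finally show ?thesis unfolding increments_def option.case by linarith
qed

text \<open>A Lipschitz constant of \<^const>\<open>decode\<close>; it must not depend on \<open>k\<close>.\<close>

definition lip_const :: real where
  "lip_const = 2 * real N * (3 * K + 1) + 2 * real q * (2 * real N * (3 * K + 1) + 12 * real N * ((1 + \<epsilon>) / \<epsilon>)) +
    6 * real N * (1 + real q)"

lemma lip_operator_decode: "lip_operator (int_grid d) (sup_dist d) M \<rho> lip_const decode"
  unfolding lip_operator_def
proof (intro conjI ballI allI impI)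
  show "(\<lambda>F. decode F p) \<in> span (ev ` int_grid d)" if "p \<in> M" for p
  proof -
    let ?x = "ints p" and ?y = "geos p"
    have x: "?x \<in> int_grid d" using that by (simp add: mem_M_iff)
    have "(\<lambda>F. decode F p) =
        (\<lambda>F. collect F None ?x) + (\<Sum>\<theta>\<in>vals ?y. (\<lambda>F. collect F (Some (\<theta>, keep {\<theta>..} ?y)) ?x))"
      by (rule ext) (simp add: decode_def sum_fun_apply)
    also have "\<dots> \<in> span (ev ` int_grid d)" by (intro span_add span_sum collect_span[OF x])
    finally show ?thesis .
  qed
next
  fix L F assume L: "0 \<le> L" and F: "lip_le (int_grid d) (sup_dist d) L F"
  let ?R = "(1 + \<epsilon>) / \<epsilon>"
  let ?K1 = "2 * real N * (3 * K + 1)"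
  have K1: "0 \<le> ?K1" and R: "0 \<le> ?R" using K \<epsilon> by auto
  have step: "Some (\<theta>, keep {\<theta>..} (geos p)) \<in> geo_layers \<epsilon> d q" if "p \<in> M" "\<theta> \<in> vals (geos p)" for p \<theta>
    using that vals_geo[of "geos p"] keep_mem[of "geos p"] unfolding geo_layers_def mem_M_iff by blast
  define h where "h p \<theta> = collect F (Some (\<theta>, keep {\<theta>..} (geos p))) (ints p)" for p \<theta>
  have None: "None \<in> geo_layers \<epsilon> d q" by (simp add: geo_layers_def)
  have bound: "\<bar>collect F l (ints p)\<bar> \<le> 3 * real N * L * a"
    if "p \<in> M" "l \<in> geo_layers \<epsilon> d q" "geo_scale k l \<noteq> 0" "real (geo_scale k l) \<le> a" for p l a
  proof -
    have "\<bar>collect F l (ints p)\<bar> \<le> 3 * real N * L * real (geo_scale k l)"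
      using that by (intro collect_bound F L) (auto simp: mem_M_iff)
    also have "\<dots> \<le> 3 * real N * L * a" using that(4) L by (intro mult_left_mono) auto
    finally show ?thesis .
  qed
  have scale: "geo_scale k (Some (\<theta>, u)) \<noteq> 0" "real (geo_scale k (Some (\<theta>, u))) \<le> 2 * \<theta>"
    "k \<noteq> 0 \<Longrightarrow> geo_scale k (Some (\<theta>, u)) \<le> k" if "1 \<le> \<theta>" for \<theta> u
  proof -
    have "real (nat \<lceil>\<theta>\<rceil>) \<le> 2 * \<theta>" using that by linarith
    then show "geo_scale k (Some (\<theta>, u)) \<noteq> 0" "real (geo_scale k (Some (\<theta>, u))) \<le> 2 * \<theta>"
      "k \<noteq> 0 \<Longrightarrow> geo_scale k (Some (\<theta>, u)) \<le> k"
      using that by (auto simp: geo_scale_def)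
  qed
  have vals_ge: "1 \<le> \<theta>" if "p \<in> M" "\<theta> \<in> vals (geos p)" for p \<theta>
    using that vals_geo[of "geos p"] geo_ge[of \<theta>] \<epsilon> by (force simp: mem_M_iff)
  have small: "\<bar>h p \<theta>\<bar> \<le> 6 * real N * L * \<theta>" if "p \<in> M" "\<theta> \<in> vals (geos p)" for p \<theta>
    using bound[OF that(1) step[OF that] scale(1,2)[OF vals_ge[OF that]]] by (simp add: h_def mult_ac)
  \<comment> \<open>A geometric coordinate at which \<open>p\<close> and \<open>p'\<close> differ is at most \<open>?R\<close> times their
    distance, so above this threshold both points pass through the same layers.\<close>
  have vals_agree: "\<theta> \<in> vals (geos p') \<and> keep {\<theta>..} (geos p) = keep {\<theta>..} (geos p')"
    if "p \<in> M" "p' \<in> M" "\<theta> \<in> vals (geos p)" "?R * sup_dist (d + q) p p' < \<theta>" for p p' \<theta>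
  proof -
    have eq: "p i = p' i" if i: "i \<in> {d..<d + q}" and big: "\<theta> \<le> p i \<or> \<theta> \<le> p' i" for i
    proof (rule ccontr)
      assume ne: "p i \<noteq> p' i"
      have g: "p i \<in> geo \<epsilon>" "p' i \<in> geo \<epsilon>"
        using \<open>p \<in> M\<close> \<open>p' \<in> M\<close> i by (auto simp: mem_M_iff geo_grid_def PiE_def Pi_def)
      have "max (p i) (p' i) \<le> ?R * \<bar>p i - p' i\<bar>"
        using geo_le_distance[OF g ne] geo_le_distance[OF g(2,1) ne[symmetric]]
        by (simp add: abs_minus_commute)
      also have "\<dots> \<le> ?R * sup_dist (d + q) p p'" using i R by (intro mult_left_mono sup_dist_ge) auto
      finally show False using big \<open>?R * sup_dist (d + q) p p' < \<theta>\<close> by auto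
    qed
    have "keep {\<theta>..} (geos p) = keep {\<theta>..} (geos p')"
    proof -
      have "(if geos p i \<in> {\<theta>..} then geos p i else 1 + \<epsilon>) = (if geos p' i \<in> {\<theta>..} then geos p' i else 1 + \<epsilon>)"
        if "i \<in> {d..<d + q}" for i
        using eq[OF that] that by auto
      then show ?thesis unfolding keep_def by (intro restrict_ext) blast
    qed
    moreover obtain i where i: "i \<in> {d..<d + q}" "p i = \<theta>" "\<theta> \<noteq> 1 + \<epsilon>"
      using \<open>\<theta> \<in> vals (geos p)\<close> by (auto simp: vals_def)
    then have "p' i = \<theta>" using eq[of i] by simp
    then have "\<theta> \<in> vals (geos p')" using i by (auto simp: vals_def intro!: image_eqI[of _ _ i])
    ultimately show ?thesis by blast
  qed
  show "lip_le M \<rho> (lip_const * L) (decode F)"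
    unfolding lip_le_def
  proof (intro ballI)
    fix p p' assume p: "p \<in> M" and p': "p' \<in> M"
    let ?\<delta> = "sup_dist (d + q) p p'"
    have \<delta>: "0 \<le> ?\<delta>" by (rule sup_dist_nonneg)
    have ints: "ints p \<in> int_grid d" "ints p' \<in> int_grid d" using p p' by (simp_all add: mem_M_iff)
    have "sup_dist d (ints p) (ints p') \<le> ?\<delta>"
      using sup_dist_ge[of _ "d + q" p p'] \<delta> by (auto simp: sup_dist_le_iff)
    then have lip: "\<bar>collect F l (ints p) - collect F l (ints p')\<bar> \<le> ?K1 * L * ?\<delta>"
      if "l \<in> geo_layers \<epsilon> d q" for l
      using lip_leD[OF collect_lip[OF F L that] ints] mult_nonneg_nonneg[OF K1 L]
      by (meson mult_left_mono order_trans)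
    define t where "t p \<theta> = (if \<theta> \<in> vals (geos p) then h p \<theta> else 0)" for p \<theta>
    let ?B = "(?K1 + 12 * real N * ?R) * L * ?\<delta>"
    have K2: "0 \<le> ?K1 + 12 * real N * ?R"
      using K1 mult_nonneg_nonneg[OF _ R, of "12 * real N"] by linarith
    have B: "0 \<le> ?B" by (intro mult_nonneg_nonneg[OF mult_nonneg_nonneg] K2 L \<delta>)
    \<comment> \<open>Large values of \<open>\<theta>\<close> give the same layer for both points, and small ones a small term.\<close>
    have terms: "\<bar>t p \<theta> - t p' \<theta>\<bar> \<le> ?B" if \<theta>: "\<theta> \<in> vals (geos p) \<union> vals (geos p')" for \<theta>
    proof (cases "?R * ?\<delta> < \<theta>")
      case True
      have "\<theta> \<in> vals (geos p)" "\<theta> \<in> vals (geos p')" "keep {\<theta>..} (geos p) = keep {\<theta>..} (geos p')"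
        using \<theta> vals_agree[OF p p' _ True] vals_agree[OF p' p, of \<theta>] True sup_dist_commute[of "d + q" p p']
        by auto
      then have "\<bar>t p \<theta> - t p' \<theta>\<bar> \<le> ?K1 * L * ?\<delta>"
        using lip[OF step[OF p, of \<theta>]] by (simp add: t_def h_def)
      also have "?K1 \<le> ?K1 + 12 * real N * ?R"
        using mult_nonneg_nonneg[OF _ R, of "12 * real N"] by linarith
      then have "?K1 * L * ?\<delta> \<le> ?B" using L \<delta> by (intro mult_right_mono)
      finally show ?thesis .
    next
      case False
      have "\<bar>t r \<theta>\<bar> \<le> 6 * real N * L * (?R * ?\<delta>)" if "r \<in> M" for r
      proof (cases "\<theta> \<in> vals (geos r)")
        case True
        have "\<bar>h r \<theta>\<bar> \<le> 6 * real N * L * \<theta>" by (rule small[OF that True])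
        also have "\<dots> \<le> 6 * real N * L * (?R * ?\<delta>)" using False L by (intro mult_left_mono) auto
        finally show ?thesis using True by (simp add: t_def)
      next
        case False
        have "0 \<le> 6 * real N * L * (?R * ?\<delta>)" using R L \<delta> by (intro mult_nonneg_nonneg) auto
        then show ?thesis using False by (simp add: t_def)
      qed
      from this[OF p] this[OF p']
      have "\<bar>t p \<theta> - t p' \<theta>\<bar> \<le> 2 * (6 * real N * L * (?R * ?\<delta>))" by linarith
      also have "\<dots> = 12 * real N * ?R * L * ?\<delta>" by (simp only: mult_ac)
      also have "\<dots> \<le> ?B" using K1 L \<delta> by (intro mult_right_mono) auto
      finally show ?thesis .
    qed
    have sums: "decode F r = collect F None (ints r) + sum (t r) (vals (geos r))" for r
      unfolding decode_def t_def h_def by simp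
    have "\<bar>sum (t p) (vals (geos p)) - sum (t p') (vals (geos p'))\<bar> \<le> 2 * real q * ?B"
      by (rule sum_active_diff_le[OF finite_vals finite_vals card_vals card_vals _ terms])
        (use B in \<open>auto simp: t_def\<close>)
    then have 1: "\<bar>decode F p - decode F p'\<bar> \<le> ?K1 * L * ?\<delta> + 2 * real q * ?B"
      using lip[OF None] unfolding sums by linarith
    have nn: "0 \<le> lip_const * L - (?K1 * L + 2 * real q * ((?K1 + 12 * real N * ?R) * L))"
      "0 \<le> lip_const * L - 6 * real N * (1 + real q) * L"
    proof -
      have "lip_const * L - (?K1 * L + 2 * real q * ((?K1 + 12 * real N * ?R) * L)) =
          6 * real N * (1 + real q) * L"
        unfolding lip_const_def by (simp only: distrib_right mult.assoc)
      then show "0 \<le> lip_const * L - (?K1 * L + 2 * real q * ((?K1 + 12 * real N * ?R) * L))"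
        using L by simp
      have "lip_const * L - 6 * real N * (1 + real q) * L =
          (?K1 + 2 * real q * (?K1 + 12 * real N * ?R)) * L"
        unfolding lip_const_def by (simp only: distrib_right mult.assoc)
      moreover have "0 \<le> ?K1 + 2 * real q * (?K1 + 12 * real N * ?R)"
        using K1 mult_nonneg_nonneg[OF _ K2, of "2 * real q"] by linarith
      ultimately show "0 \<le> lip_const * L - 6 * real N * (1 + real q) * L"
        using L by simp
    qed
    have "\<bar>decode F p - decode F p'\<bar> \<le> lip_const * L * ?\<delta>"
      using 1 mult_nonneg_nonneg[OF nn(1) \<delta>] by (simp add: algebra_simps)
    moreover have "\<bar>decode F p - decode F p'\<bar> \<le> lip_const * L * real k" if k: "k \<noteq> 0"
    proof -
      have "\<bar>decode F r\<bar> \<le> 3 * real N * L * real k + real q * (3 * real N * L * real k)" if r: "r \<in> M" for r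
      proof -
        have "\<bar>t r \<theta>\<bar> \<le> 3 * real N * L * real k" if "\<theta> \<in> vals (geos r)" for \<theta>
          using bound[OF r step[OF r that] scale(1)[OF vals_ge[OF r that]], of "real k"]
            scale(3)[OF vals_ge[OF r that] k] that by (simp add: t_def h_def)
        then have "(\<Sum>\<theta>\<in>vals (geos r). \<bar>t r \<theta>\<bar>) \<le> real (card (vals (geos r))) * (3 * real N * L * real k)"
          by (rule sum_bounded_above)
        also have "\<dots> \<le> real q * (3 * real N * L * real k)"
          using card_vals[of "geos r"] L by (intro mult_right_mono) auto
        finally have "\<bar>sum (t r) (vals (geos r))\<bar> \<le> real q * (3 * real N * L * real k)"
          using sum_abs[of "t r" "vals (geos r)"] by linarith
        moreover have "\<bar>collect F None (ints r)\<bar> \<le> 3 * real N * L * real k"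
          using k by (intro bound r None) (auto simp: geo_scale_def)
        ultimately show ?thesis unfolding sums by linarith
      qed
      from this[OF p] this[OF p']
      have "\<bar>decode F p - decode F p'\<bar> \<le> 6 * real N * (1 + real q) * L * real k"
        by (simp add: algebra_simps)
      then show ?thesis using mult_nonneg_nonneg[OF nn(2), of "real k"] by (simp add: algebra_simps)
    qed
    ultimately show "\<bar>decode F p - decode F p'\<bar> \<le> lip_const * L * \<rho> p p'"
      by (auto simp: capped_metric_mdist min_def)
  qed
qed

lemma lip_free_int_geo_grid_complemented:
  assumes b: "b \<in> M" and b': "b' \<in> int_grid d" and C: "lip_const * 12 \<le> C"
  shows "C_isomorphic_to_C_complemented C
      (lip_free (submetric (capped_metric (real k) (sup_metric (d + q))) M) b)
      (lip_free (submetric (sup_metric d) (int_grid d)) b')"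
proof (rule lip_free_complementedI[where A = decode and B = encode and K = lip_const and L = 12])
  have M: "mspace (submetric (capped_metric (real k) (sup_metric (d + q))) M) = M"
    using int_geo_grid_subset by auto
  show "0 \<le> lip_const" unfolding lip_const_def using K \<epsilon> by (intro add_nonneg_nonneg mult_nonneg_nonneg) auto
  show "b \<in> mspace (submetric (capped_metric (real k) (sup_metric (d + q))) M)"
    using b by (simp only: M)
  show "b' \<in> mspace (submetric (sup_metric d) (int_grid d))" using b' by (simp only: mspace_int_grid)
  show "lip_operator (mspace (submetric (sup_metric d) (int_grid d)))
      (mdist (submetric (sup_metric d) (int_grid d)))
      (mspace (submetric (capped_metric (real k) (sup_metric (d + q))) M))
      (mdist (submetric (capped_metric (real k) (sup_metric (d + q))) M)) lip_const decode"
    unfolding M mspace_int_grid mdist_submetric mdist_sup_metric by (rule lip_operator_decode)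
  show "lip_operator (mspace (submetric (capped_metric (real k) (sup_metric (d + q))) M))
      (mdist (submetric (capped_metric (real k) (sup_metric (d + q))) M))
      (mspace (submetric (sup_metric d) (int_grid d)))
      (mdist (submetric (sup_metric d) (int_grid d))) 12 encode"
    unfolding M mspace_int_grid mdist_submetric mdist_sup_metric by (rule lip_operator_encode)
  show "decode (\<lambda>z. g z - a) x = decode g x" for g a x by (simp add: decode_def collect_const)
  show "decode (encode f) x - decode (encode f) b = f x - f b"
    if "x \<in> mspace (submetric (capped_metric (real k) (sup_metric (d + q))) M)" for f x
    using that b unfolding M by (simp add: decode_encode)
qed (use C in auto)

end

theorem lemma2:
  fixes \<epsilon> :: real and d q :: nat
  assumes "\<epsilon> > 0" and "d \<ge> 1"
  shows "\<exists>C::real. C \<ge> 1 \<and> (\<forall>b\<in>int_geo_grid \<epsilon> d q. \<forall>b'\<in>int_grid d.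
    C_isomorphic_to_C_complemented C
      (lip_free (submetric (sup_metric (d + q)) (int_geo_grid \<epsilon> d q)) b)
      (lip_free (submetric (sup_metric d) (int_grid d)) b') \<and>
    (\<forall>k::nat. k \<ge> 1 \<longrightarrow>
      C_isomorphic_to_C_complemented C
        (lip_free (submetric (capped_metric (real k) (sup_metric (d + q))) (int_geo_grid \<epsilon> d q)) b)
        (lip_free (submetric (sup_metric d) (int_grid d)) b')))"
proof -
  define K where "K = 6 + real d"
  define N :: nat where "N = 2 + 2 ^ d"
  \<comment> \<open>The parameters of the atlases depend on \<open>d\<close> only, hence the constant does not depend on \<open>k\<close>.\<close>
  define C where "C = max 1 (geometric_layers.lip_const \<epsilon> q K N * 12)"
  have "C_isomorphic_to_C_complemented C
      (lip_free (submetric (capped_metric (real k) (sup_metric (d + q))) (int_geo_grid \<epsilon> d q)) b)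
      (lip_free (submetric (sup_metric d) (int_grid d)) b')"
    if b: "b \<in> int_geo_grid \<epsilon> d q" "b' \<in> int_grid d" for k b b'
  proof -
    have "\<forall>l. \<exists>s c \<psi>. atlas d (geo_scale k l) K N s c \<psi>"
      unfolding K_def N_def using atlas_exists[OF assms(2)] by blast
    then obtain s c \<psi> where "\<And>l. atlas d (geo_scale k l) K N (s l) (c l) (\<psi> l)" by metis
    then interpret geometric_layers \<epsilon> d q k K N s c \<psi>
      using assms countable_geo_layers by unfold_locales (auto simp: K_def geo_layers_def)
    show ?thesis
      by (rule lip_free_int_geo_grid_complemented[OF b]) (simp add: C_def)
  qed
  note * = this
  have "capped_metric (real 0) (sup_metric (d + q)) = sup_metric (d + q)"
    by (simp add: capped_metric)
  then show ?thesis
    using * *[of _ _ 0] by (intro exI[of _ C]) (auto simp: C_def)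
qed

end
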